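(* Suppose the words $w,w_1,w_2$ are each of length $n-1$. Let $\mathbb L_w$ be the poset of lattice paths on $G_w$, and let $\mathbb L_1=\mathbb L_{w_1}$, $\mathbb L_2=\mathbb L_{w_2}$ be the posets of lattice paths on $G_1=G_{w_1}$ and $G_2=G_{w_2}$, with snake graph representations $\mathbb L_w\cong\mathbb I_w$, $\mathbb L_1\cong\mathbb I_1$, $\mathbb L_2\cong\mathbb I_2$. (a) Each poset $\mathbb O_j^{n+2}$ is isomorphic to the poset of lattice paths in a rectangular grid. (b) The rank generating function of the graded poset $\mathbb O_j^{n+2}$ is equal to a $q$-binomial coefficient. (c) Each poset $\mathbb O_j^{n+2}$ is isomorphic to a closed interval $[\varnothing,\lambda]$ in Young's lattice, with $\lambda$ a rectangular Young diagram. (d) Each lattice $\mathbb L_w\cong\mathbb I_w$ is isomorphic to a closed interval in one of the posets $\mathbb O_j^{n+2}$. (e) The two posets $\mathbb L_1\cong\mathbb I_1$ and $\mathbb L_2\cong\mathbb I_2$ are embedded as intervals into the same $\mathbb O_j^{n+2}$ if and only if $G_1$ and $G_2$ are both elements of the same poset $\mathbb O_i^n$. Moreover, each $\mathbb O_j^{n+2}$ is covered by the collection of such embeddings.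
   Context: A word is a string over $\{a,b\}$; with $a^*=b,b^*=a$, the dual of $w=w_1w_2w_3\cdots$ is $w^*=w_1^*w_2w_3^*w_4\cdots$. A snake graph with $n$ tiles is a planar graph in $\mathbb Z^2$ formed by unit squares $T_1,\dots,T_n$, $T_1$ having SW corner $(0,0)$, where each $T_{i+1}$ is glued (sharing an edge) directly to the right of or directly above $T_i$. Its shape $\mathrm{sh}(G)$ is the word of length $n-1$ whose $i$-th letter is $a$ if $T_{i+1}$ is to the right of $T_i$ and $b$ if it is above. $G_w$ denotes the snake graph attached to $w$; it is the snake graph of shape $w^*$ (so every snake graph is $G_w$ for a unique $w$). A snake graph is straight if all its tiles lie in one row or column. A lattice path on $G_w$ is a path of $n+1$ unit steps right or up, along edges of $G_w$, from the SW vertex of $T_1$ to the NE vertex of $T_n$. $\mathbb L_w$ is the poset of these paths in which $L_2$ covers $L_1$ iff $L_2$ is obtained from $L_1$ by replacing the S and E edges of some tile with its W and N edges. $\mathcal L^m$ is the groupoid whose objects are the snake graphs with $m$ tiles, with morphisms generated by the local move on shapes replacing a consecutive subword $ab$ by $ba$ or conversely. (Straight snake graphs are alone in their orbits.) For $m\geq 3$ each orbit contains exactly one snake graph $G_-^{m,j}$ of shape $a^{k_1-1}b^{k_2-1}=a^{k_1-1}b^{j}$, $m=k_1+k_2-1$; the orbit is denoted $O_j^m$. $\mathbb O_j^m$ is this orbit made into a poset with minimal element $G_-^{m,j}$, where performing a swap $ab\mapsto ba$ in the shape is going up by a covering relation. In the statements about $\mathbb O_j^{n+2}$, $j$ ranges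 over the $n$ non-trivial (non-straight) orbits $1\le j\le n$; in (e), "$G_1$ and $G_2$ are elements of the same $\mathbb O_i^n$" means they lie in the same orbit of $\mathcal L^n$ (for straight snake graphs this is a one-element orbit). $\mathbb I_w$: to a lattice path $L$ on $G_w$ associate the snake graph with $n+2$ tiles whose shape is the word of length $n+1$ obtained by reading each right step of $L$ as $a$ and each up step as $b$. $\mathbb I_w\cong\mathbb L_w$ is the poset so obtained (a set of objects of $\mathcal L^{n+2}$). The poset of lattice paths in a rectangular grid consists of the right/up lattice paths from the SW to the NE corner, with the same type of covering relation (replacing S,E edges of a unit square by W,N edges). The $q$-binomial coefficient is $\binom{n}{k}_q=\frac{[n]_q!}{[k]_q![n-k]_q!}$ with $[k]_q!=(1+q)(1+q+q^2)\cdots(1+q+\dots+q^{k-1})$. Young's lattice is the poset of Young diagrams of partitions ordered by inclusion. *)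

theory Defs
  imports "HOL-Computational_Algebra.Polynomial"
begin

section \<open>Words and points\<close>

datatype letter = La | Lb

type_synonym word = "letter list"
type_synonym point = "int \<times> int"

fun flip :: "letter \<Rightarrow> letter" where
  "flip La = Lb"
| "flip Lb = La"

text \<open>The dual word: the letters in odd positions (counted from 1) are flipped.\<close>

fun dual :: "word \<Rightarrow> word" where
  "dual [] = []"
| "dual [x] = [flip x]"
| "dual (x # y # w) = flip x # y # dual w"

text \<open>The letter \<open>a\<close> is a unit step to the right, the letter \<open>b\<close> a unit step up.\<close>

fun step :: "letter \<Rightarrow> point \<Rightarrow> point" where
  "step La (x, y) = (x + 1, y)"
| "step Lb (x, y) = (x, y + 1)"

definition unit_step :: "point \<Rightarrow> point \<Rightarrow> bool" where
  "unit_step p q \<longleftrightarrow> q = step La p \<or> q = step Lb p"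

fun walk :: "point \<Rightarrow> word \<Rightarrow> point list" where
  "walk p [] = [p]"
| "walk p (x # u) = p # walk (step x p) u"

text \<open>The word of right and up steps between consecutive points; only meaningful if
  any two consecutive points satisfy \<^const>\<open>unit_step\<close>.\<close>

fun steps :: "point list \<Rightarrow> word" where
  "steps (p # q # ps) = (if q = step La p then La else Lb) # steps (q # ps)"
| "steps ps = []"


section \<open>Snake graphs\<close>

text \<open>A tile is represented by its south-west corner.\<close>

definition SW :: "point \<Rightarrow> point" where "SW t = t"
definition SE :: "point \<Rightarrow> point" where "SE t = step La t"
definition NW :: "point \<Rightarrow> point" where "NW t = step Lb t"
definition NE :: "point \<Rightarrow> point" where "NE t = step La (step Lb t)"

definition tile_edges :: "point \<Rightarrow> point set set" where
  "tile_edges t = {{SW t, SE t}, {SE t, NE t}, {SW t, NW t}, {NW t, NE t}}"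

text \<open>A snake graph is represented by the list of its tiles \<open>T\<^sub>1, \<dots>, T\<^sub>m\<close>; the graph itself has
  the edges \<open>\<Union>(tile_edges ` set T)\<close>.\<close>

definition snake_graphs :: "nat \<Rightarrow> point list set" where
  "snake_graphs m = {T. length T = m \<and> T \<noteq> [] \<and> hd T = (0, 0) \<and> successively unit_step T}"

definition shape :: "point list \<Rightarrow> word" where
  "shape T = steps T"

definition snake_of_shape :: "word \<Rightarrow> point list" where
  "snake_of_shape u = walk (0, 0) u"

definition G :: "word \<Rightarrow> point list" where
  "G w = snake_of_shape (dual w)"


section \<open>Posets\<close>

text \<open>Posets are reflexive relations, so the underlying set of \<open>r\<close> is \<^term>\<open>Field r\<close>.
  The next definition is the order on \<open>A\<close> generated by the relation \<open>R\<close> on \<open>A\<close>.\<close>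

definition generated_order :: "'a set \<Rightarrow> 'a rel \<Rightarrow> 'a rel" where
  "generated_order A R = Restr (R\<^sup>*) A"

definition covers :: "'a rel \<Rightarrow> 'a \<Rightarrow> 'a \<Rightarrow> bool" where
  "covers r x y \<longleftrightarrow> (x, y) \<in> r \<and> x \<noteq> y \<and> (\<forall>z. (x, z) \<in> r \<and> (z, y) \<in> r \<longrightarrow> z = x \<or> z = y)"

text \<open>The library predicate \<open>iso\<close> is defined for arbitrary relations; see \<open>iso_iff2\<close>: it
  asks for a bijection of the fields that preserves and reflects the relation.\<close>

definition isomorphic :: "'a rel \<Rightarrow> 'b rel \<Rightarrow> bool" (infix "\<simeq>" 50) where
  "r \<simeq> s \<longleftrightarrow> (\<exists>f. iso r s f)"

definition closed_interval :: "'a rel \<Rightarrow> 'a \<Rightarrow> 'a \<Rightarrow> 'a rel" where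
  "closed_interval r x y = Restr r {z. (x, z) \<in> r \<and> (z, y) \<in> r}"

text \<open>\<open>s\<close> is (literally, not only up to isomorphism) a nonempty closed interval of \<open>r\<close>
  with the induced order.\<close>

definition interval_in :: "'a rel \<Rightarrow> 'a rel \<Rightarrow> bool" where
  "interval_in s r \<longleftrightarrow> (\<exists>x y. (x, y) \<in> r \<and> s = closed_interval r x y)"

definition rank_function :: "'a rel \<Rightarrow> ('a \<Rightarrow> nat) \<Rightarrow> bool" where
  "rank_function r \<rho> \<longleftrightarrow>
     (\<forall>x\<in>Field r. (\<forall>z. (z, x) \<in> r \<longrightarrow> z = x) \<longrightarrow> \<rho> x = 0) \<and>
     (\<forall>x y. covers r x y \<longrightarrow> \<rho> y = \<rho> x + 1)"

definition graded :: "'a rel \<Rightarrow> bool" where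
  "graded r \<longleftrightarrow> Partial_order r \<and> finite (Field r) \<and> (\<exists>\<rho>. rank_function r \<rho>)"

text \<open>On the field of a graded poset the rank function is uniquely determined.\<close>

definition rank :: "'a rel \<Rightarrow> 'a \<Rightarrow> nat" where
  "rank r = (SOME \<rho>. rank_function r \<rho>)"

definition rank_generating_function :: "'a rel \<Rightarrow> int poly" where
  "rank_generating_function r = (\<Sum>x\<in>Field r. monom 1 (rank r x))"


section \<open>Lattice paths\<close>

text \<open>A right/up lattice path from the origin to \<open>e\<close> along the edges of the tiles in \<open>S\<close>, given
  as the list of its vertices. The number of steps is the sum of the coordinates of \<open>e\<close>; for a
  snake graph with \<open>n\<close> tiles and \<open>e\<close> the north-east vertex of the last tile this is \<open>n + 1\<close>.\<close>

definition lattice_paths :: "point set \<Rightarrow> point \<Rightarrow> point list set" where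
  "lattice_paths S e = {L. L \<noteq> [] \<and> hd L = (0, 0) \<and> last L = e \<and>
     successively (\<lambda>p q. unit_step p q \<and> {p, q} \<in> \<Union>(tile_edges ` S)) L}"

definition tile_move :: "point set \<Rightarrow> point \<Rightarrow> point list rel" where
  "tile_move S e = {(L1, L2). L1 \<in> lattice_paths S e \<and> L2 \<in> lattice_paths S e \<and>
     (\<exists>t\<in>S. \<exists>xs ys. L1 = xs @ [SW t, SE t, NE t] @ ys \<and> L2 = xs @ [SW t, NW t, NE t] @ ys)}"

definition path_poset :: "point set \<Rightarrow> point \<Rightarrow> point list rel" where
  "path_poset S e = generated_order (lattice_paths S e) (tile_move S e)"

definition L_poset :: "word \<Rightarrow> point list rel" where
  "L_poset w = path_poset (set (G w)) (NE (last (G w)))"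

text \<open>The rectangular grid with \<open>p\<close> columns and \<open>q\<close> rows of unit squares.\<close>

definition grid_poset :: "nat \<Rightarrow> nat \<Rightarrow> point list rel" where
  "grid_poset p q = path_poset ({0..<int p} \<times> {0..<int q}) (int p, int q)"


section \<open>Orbits of snake graphs\<close>

definition swap_up :: "nat \<Rightarrow> point list rel" where
  "swap_up m = {(T, T'). T \<in> snake_graphs m \<and> T' \<in> snake_graphs m \<and>
     (\<exists>u v. shape T = u @ [La, Lb] @ v \<and> shape T' = u @ [Lb, La] @ v)}"

text \<open>Connectedness by morphisms in the groupoid generated by the local moves.\<close>

definition same_orbit :: "nat \<Rightarrow> point list rel" where
  "same_orbit m = Restr ((swap_up m \<union> (swap_up m)\<inverse>)\<^sup>*) (snake_graphs m)"

definition orbits :: "nat \<Rightarrow> point list set set" where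
  "orbits m = snake_graphs m // same_orbit m"

definition G_minus :: "nat \<Rightarrow> nat \<Rightarrow> point list" where
  "G_minus m j = snake_of_shape (replicate (m - 1 - j) La @ replicate j Lb)"

definition O_orbit :: "nat \<Rightarrow> nat \<Rightarrow> point list set" where
  "O_orbit m j = same_orbit m `` {G_minus m j}"

definition O_poset :: "nat \<Rightarrow> nat \<Rightarrow> point list rel" where
  "O_poset m j = generated_order (O_orbit m j) (swap_up m)"

text \<open>The snake graph whose shape is the step word of a lattice path. In the present encoding
  the tile list of this snake graph happens to coincide with the vertex list of the path.\<close>

definition path_snake :: "point list \<Rightarrow> point list" where
  "path_snake L = snake_of_shape (steps L)"

definition I_poset :: "word \<Rightarrow> point list rel" where
  "I_poset w = map_prod path_snake path_snake ` L_poset w"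


section \<open>Young's lattice\<close>

definition is_partition :: "nat list \<Rightarrow> bool" where
  "is_partition \<kappa> \<longleftrightarrow> sorted_wrt (\<ge>) \<kappa> \<and> 0 \<notin> set \<kappa>"

definition young_diagram :: "nat list \<Rightarrow> (nat \<times> nat) set" where
  "young_diagram \<kappa> = {(i, j). i < length \<kappa> \<and> j < \<kappa> ! i}"

definition young_diagrams :: "(nat \<times> nat) set set" where
  "young_diagrams = young_diagram ` {\<kappa>. is_partition \<kappa>}"

definition young_lattice :: "(nat \<times> nat) set rel" where
  "young_lattice = {(D, E). D \<in> young_diagrams \<and> E \<in> young_diagrams \<and> D \<subseteq> E}"


section \<open>The \<open>q\<close>-binomial coefficients\<close>

definition q_fact :: "nat \<Rightarrow> int poly" where
  "q_fact k = (\<Prod>i=1..k. \<Sum>l<i. monom 1 l)"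

text \<open>The division is exact for \<open>k \<le> n\<close>; \<open>div\<close> is then the exact quotient in \<open>\<int>[q]\<close>.\<close>

definition q_binomial :: "nat \<Rightarrow> nat \<Rightarrow> int poly" where
  "q_binomial n k = q_fact n div (q_fact k * q_fact (n - k))"


section \<open>Basic facts\<close>

lemma step_inject [simp]: "step La p \<noteq> step Lb p" "step Lb p \<noteq> step La p"
  by (cases p; simp)+

lemma hd_walk [simp]: "hd (walk p u) = p"
  by (cases u) auto

lemma walk_not_Nil [simp]: "walk p u \<noteq> []"
  by (cases u) auto

lemma length_walk [simp]: "length (walk p u) = Suc (length u)"
  by (induction u arbitrary: p) auto

lemma successively_walk: "successively unit_step (walk p u)"
proof (induction u arbitrary: p)
  case (Cons x u)
  then show ?case
    by (cases x) (auto simp: successively_Cons unit_step_def)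
qed simp

lemma steps_walk [simp]: "steps (walk p u) = u"
proof (induction u arbitrary: p)
  case (Cons x u)
  then show ?case
    using Cons[of "step x p"] by (cases u; cases x) auto
qed simp

lemma walk_steps: "successively unit_step L \<Longrightarrow> L \<noteq> [] \<Longrightarrow> walk (hd L) (steps L) = L"
  by (induction L rule: steps.induct) (auto simp: unit_step_def)

lemma snake_of_shape_in: "snake_of_shape u \<in> snake_graphs (Suc (length u))"
  by (simp add: snake_of_shape_def snake_graphs_def successively_walk)

lemma shape_snake_of_shape: "shape (snake_of_shape u) = u"
  by (simp add: snake_of_shape_def shape_def)

lemma snake_of_shape_shape: "T \<in> snake_graphs m \<Longrightarrow> snake_of_shape (shape T) = T"
  using walk_steps[of T] by (auto simp: snake_of_shape_def shape_def snake_graphs_def)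

lemma dual_dual: "dual (dual w) = w"
proof (induction w rule: dual.induct)
  case (2 x) then show ?case by (cases x) auto
next
  case (3 x y w) then show ?case by (cases x) auto
qed simp

lemma path_snake_id: "L \<in> lattice_paths S e \<Longrightarrow> path_snake L = L"
proof -
  assume L: "L \<in> lattice_paths S e"
  then have "successively unit_step L"
    by (auto simp: lattice_paths_def elim: successively_mono)
  then show ?thesis
    using L walk_steps[of L] by (auto simp: path_snake_def snake_of_shape_def lattice_paths_def)
qed

lemma Field_generated_order [simp]: "Field (generated_order A R) = A"
  by (auto simp: generated_order_def Field_def)

lemma iso_L_I: "iso (L_poset w) (I_poset w) path_snake"
proof -
  have id: "path_snake L = L" if "L \<in> Field (L_poset w)" for L
    using that path_snake_id by (auto simp: L_poset_def path_poset_def)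
  have "I_poset w = id ` L_poset w"
    unfolding I_poset_def by (rule image_cong) (auto simp: id FieldI1 FieldI2)
  then show ?thesis
    using id by (auto simp: iso_iff2 bij_betw_def inj_on_def)
qed

text \<open>If some integer statistic grows by exactly one along \<open>R\<close>, the generated order is a
  partial order whose covering relation is exactly \<open>R\<close>.\<close>

lemma
  fixes h :: "'a \<Rightarrow> int"
  assumes R: "R \<subseteq> A \<times> A" and h: "\<And>x y. (x, y) \<in> R \<Longrightarrow> h y = h x + 1"
  shows generated_order_partial_order: "partial_order_on A (generated_order A R)"
    and generated_order_covers: "covers (generated_order A R) x y \<longleftrightarrow> (x, y) \<in> R"
proof -
  have le: "x = y \<or> h x < h y" if "(x, y) \<in> R\<^sup>*" for x y
    using that
  proof induction
    case (step y z)
    then show ?case using h[OF step(2)] by auto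
  qed simp
  have "antisym (generated_order A R)"
  proof (rule antisymI)
    fix x y
    assume "(x, y) \<in> generated_order A R" "(y, x) \<in> generated_order A R"
    then show "x = y"
      using le[of x y] le[of y x] by (auto simp: generated_order_def)
  qed
  moreover have "trans (generated_order A R)"
    by (rule transI) (auto simp: generated_order_def)
  ultimately show "partial_order_on A (generated_order A R)"
    by (auto simp: partial_order_on_def preorder_on_def refl_on_def generated_order_def)
  show "covers (generated_order A R) x y \<longleftrightarrow> (x, y) \<in> R"
  proof
    assume c: "covers (generated_order A R) x y"
    then have xy: "(x, y) \<in> R\<^sup>*" "x \<noteq> y" "x \<in> A" "y \<in> A"
      by (auto simp: covers_def generated_order_def)
    then obtain z where z: "(x, z) \<in> R" "(z, y) \<in> R\<^sup>*"
      by (meson converse_rtranclE)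
    then have "z = x \<or> z = y"
      using c R xy by (auto simp: covers_def generated_order_def)
    moreover have "z \<noteq> x"
      using h[OF z(1)] by auto
    ultimately show "(x, y) \<in> R"
      using z by auto
  next
    assume xy: "(x, y) \<in> R"
    have "z = x \<or> z = y" if "(x, z) \<in> R\<^sup>*" "(z, y) \<in> R\<^sup>*" for z
      using le[OF that(1)] le[OF that(2)] h[OF xy] by auto
    then show "covers (generated_order A R) x y"
      using xy R h[OF xy] by (auto simp: covers_def generated_order_def)
  qed
qed

definition height_sum :: "point list \<Rightarrow> int" where
  "height_sum L = sum_list (map snd L)"

lemma tile_move_height: "(L1, L2) \<in> tile_move S e \<Longrightarrow> height_sum L2 = height_sum L1 + 1"
proof -
  have "snd (NW t) = snd (SE t) + 1" for t
    by (cases t) (simp add: NW_def SE_def)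
  then show "(L1, L2) \<in> tile_move S e \<Longrightarrow> ?thesis"
    by (auto simp: tile_move_def height_sum_def)
qed

lemma walk_swap_height:
  "height_sum (walk p (u @ [Lb, La] @ v)) = height_sum (walk p (u @ [La, Lb] @ v)) + 1"
proof (induction u arbitrary: p)
  case Nil
  then show ?case by (cases p) (simp add: height_sum_def)
next
  case (Cons x u)
  then show ?case by (simp add: height_sum_def)
qed

lemma swap_up_height: "(T, T') \<in> swap_up m \<Longrightarrow> height_sum T' = height_sum T + 1"
proof -
  assume "(T, T') \<in> swap_up m"
  then obtain u v where "T \<in> snake_graphs m" "T' \<in> snake_graphs m"
    "shape T = u @ [La, Lb] @ v" "shape T' = u @ [Lb, La] @ v"
    by (auto simp: swap_up_def)
  then show ?thesis
    using walk_swap_height[of "(0, 0)" u v] snake_of_shape_shape[of T m] snake_of_shape_shape[of T' m]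
    by (simp add: snake_of_shape_def)
qed

lemma path_poset_partial_order: "partial_order_on (lattice_paths S e) (path_poset S e)"
  and path_poset_covers: "covers (path_poset S e) L1 L2 \<longleftrightarrow> (L1, L2) \<in> tile_move S e"
proof -
  have R: "tile_move S e \<subseteq> lattice_paths S e \<times> lattice_paths S e"
    by (auto simp: tile_move_def)
  show "partial_order_on (lattice_paths S e) (path_poset S e)"
    unfolding path_poset_def by (rule generated_order_partial_order[where h = height_sum, OF R tile_move_height])
  show "covers (path_poset S e) L1 L2 \<longleftrightarrow> (L1, L2) \<in> tile_move S e"
    unfolding path_poset_def by (rule generated_order_covers[where h = height_sum, OF R tile_move_height])
qed

lemma O_poset_restrict:
  "O_poset m j = generated_order (O_orbit m j) (Restr (swap_up m) (O_orbit m j))"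
proof -
  have closed: "y \<in> O_orbit m j" if "x \<in> O_orbit m j" "(x, y) \<in> swap_up m" for x y
  proof -
    have "y \<in> snake_graphs m"
      using that by (auto simp: swap_up_def)
    moreover have "(G_minus m j, y) \<in> (swap_up m \<union> (swap_up m)\<inverse>)\<^sup>*"
      using that by (auto simp: O_orbit_def same_orbit_def intro: rtrancl_into_rtrancl)
    ultimately show ?thesis
      using that by (auto simp: O_orbit_def same_orbit_def)
  qed
  have "(x, y) \<in> (Restr (swap_up m) (O_orbit m j))\<^sup>* \<and> y \<in> O_orbit m j"
    if "(x, y) \<in> (swap_up m)\<^sup>*" "x \<in> O_orbit m j" for x y
    using that
  proof induction
    case (step y z)
    then have "(y, z) \<in> Restr (swap_up m) (O_orbit m j)"
      using closed by blast
    then show ?case using step by (auto intro: rtrancl_into_rtrancl)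
  qed simp
  moreover have "(Restr (swap_up m) (O_orbit m j))\<^sup>* \<subseteq> (swap_up m)\<^sup>*"
    by (rule rtrancl_mono) auto
  ultimately show ?thesis
    by (auto simp: O_poset_def generated_order_def)
qed

lemma O_poset_partial_order: "partial_order_on (O_orbit m j) (O_poset m j)"
  and O_poset_covers: "covers (O_poset m j) T T' \<longleftrightarrow>
    T \<in> O_orbit m j \<and> T' \<in> O_orbit m j \<and> (T, T') \<in> swap_up m"
proof -
  let ?R = "Restr (swap_up m) (O_orbit m j)"
  have R: "?R \<subseteq> O_orbit m j \<times> O_orbit m j"
    and h: "\<And>x y. (x, y) \<in> ?R \<Longrightarrow> height_sum y = height_sum x + 1"
    using swap_up_height by auto
  show "partial_order_on (O_orbit m j) (O_poset m j)"
    unfolding O_poset_restrict by (rule generated_order_partial_order[where h = height_sum, OF R h])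
  show "covers (O_poset m j) T T' \<longleftrightarrow>
    T \<in> O_orbit m j \<and> T' \<in> O_orbit m j \<and> (T, T') \<in> swap_up m"
    unfolding O_poset_restrict using generated_order_covers[where h = height_sum, OF R h] by auto
qed

end

theory Submission
  imports Defs
begin

text \<open>
  Tile lists and vertex lists of lattice paths are both determined by their words of right and up
  steps, so the posets of snake graphs and of paths all become sets of words ordered by the swaps
  \<open>ab \<mapsto> ba\<close>. Three observations carry the proof.

  First, the swap order is explicit. Record for each \<open>b\<close> of a word the number of letters
  \<open>a\<close> behind it; this list \<open>rows\<close> is the partition cut out by the path, and a swap adds
  one box to it. Two words with the same numbers of letters are comparable exactly if the
  partition of one is contained in that of the other (\<open>swap_le_iff_rows\<close>). In particular all
  words with \<open>p\<close> letters \<open>a\<close> and \<open>q\<close> letters \<open>b\<close> lie above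
  \<open>a\<^sup>pb\<^sup>q\<close>, so they form one orbit, and this orbit is the poset of partitions in a
  box with \<open>q\<close> rows and \<open>p\<close> columns (\<open>O_poset_young\<close>). Its rank is the size of the
  partition, and splitting words by their first letter gives the Pascal recursion of the
  \<open>q\<close>-binomial coefficients (\<open>gauss_poly_rec\<close>). A rectangular grid has no forbidden edges,
  so its path poset is equal to such an orbit (\<open>grid_poset_eq\<close>).

  Second, on the snake graph of shape \<open>s\<close> the lowest path has the word \<open>asb\<close> and
  the highest one the word \<open>bsa\<close>, and the paths on the graph are exactly the words between
  these two (\<open>snake_edge_walk\<close>). Both sides satisfy the same recursion on the first tile:
  a path either steps into the next tile at once or first goes around the first tile. Hence the path
  poset is equal to the closed interval \<open>[asb, bsa]\<close> of the orbit of words with one letter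
  \<open>b\<close> more than \<open>s\<close> (\<open>snake_path_poset_eq\<close>). So two snake graphs give intervals in the same
  orbit exactly if their shapes have equally many letters \<open>b\<close>, which means that the shapes
  are themselves in one orbit.

  Third, a word \<open>u\<close> containing both letters has a factor \<open>ab\<close> or \<open>ba\<close>;
  deleting it leaves a shape \<open>s\<close> with \<open>u\<close> in \<open>[asb, bsa]\<close>
  (\<open>exists_between\<close>). So these intervals cover the orbit.
\<close>


section \<open>Words ordered by swaps\<close>

definition words :: "nat \<Rightarrow> nat \<Rightarrow> word set" where
  "words p q = {u. count_list u La = p \<and> count_list u Lb = q}"

definition swaps :: "word rel" where
  "swaps = {(u @ [La, Lb] @ v, u @ [Lb, La] @ v) | u v. True}"

abbreviation swap_le :: "word \<Rightarrow> word \<Rightarrow> bool" (infix "\<preceq>" 50) where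
  "u \<preceq> v \<equiv> (u, v) \<in> swaps\<^sup>*"

text \<open>The parts of the partition, zeros included, whose diagram consists of the squares to the right of the
  path of the word in its bounding rectangle: each up step has one square in its row for every
  later right step.\<close>

fun rows :: "word \<Rightarrow> nat list" where
  "rows [] = []"
| "rows (La # u) = rows u"
| "rows (Lb # u) = count_list u La # rows u"

lemma letter_neq [simp]: "x \<noteq> La \<longleftrightarrow> x = Lb" "x \<noteq> Lb \<longleftrightarrow> x = La"
  by (cases x; simp)+

lemma flip_neq [simp]: "flip x \<noteq> x" "x \<noteq> flip x"
  by (cases x; simp)+

lemma flip_flip [simp]: "flip (flip x) = x"
  by (cases x) simp_all

lemma length_words: "u \<in> words p q \<Longrightarrow> length u = p + q"
proof -
  have "length u = count_list u La + count_list u Lb"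
  proof (induction u)
    case (Cons x u) then show ?case by (cases x) auto
  qed simp
  then show "u \<in> words p q \<Longrightarrow> ?thesis" by (simp add: words_def)
qed

lemma in_words_iff: "u \<in> words p q \<longleftrightarrow> length u = p + q \<and> count_list u Lb = q"
  using length_words[of u "count_list u La" "count_list u Lb"] by (auto simp: words_def)

lemma words_Nil [simp]: "[] \<in> words p q \<longleftrightarrow> p = 0 \<and> q = 0"
  by (auto simp: words_def)

lemma words_Cons [simp]:
  "La # u \<in> words p q \<longleftrightarrow> (\<exists>p'. p = Suc p' \<and> u \<in> words p' q)"
  "Lb # u \<in> words p q \<longleftrightarrow> (\<exists>q'. q = Suc q' \<and> u \<in> words p q')"
  by (auto simp: words_def)

lemma swaps_context: "u \<preceq> v \<Longrightarrow> x @ u @ y \<preceq> x @ v @ y"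
proof (induction rule: rtrancl_induct)
  case (step v v')
  have "(x @ v @ y, x @ v' @ y) \<in> swaps"
    using step(2) unfolding swaps_def by clarsimp (metis append.assoc append_Cons)
  with step(3) show ?case by (rule rtrancl_into_rtrancl)
qed simp

lemma swap_le_Cons: "u \<preceq> v \<Longrightarrow> x # u \<preceq> x # v"
  using swaps_context[of u v "[x]" "[]"] by simp

lemma swap_le_head: "La # Lb # u \<preceq> Lb # La # u"
  unfolding swaps_def by (rule r_into_rtrancl) (force intro: exI[of _ "[]"])

lemma swap_le_words: "u \<preceq> v \<Longrightarrow> u \<in> words p q \<longleftrightarrow> v \<in> words p q"
  by (induction rule: rtrancl_induct) (auto simp: swaps_def words_def)

lemma move_b_front: "x @ Lb # y \<preceq> Lb # x @ y"
proof (induction x)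
  case (Cons z x)
  have "z # x @ Lb # y \<preceq> z # Lb # x @ y"
    by (rule swap_le_Cons[OF Cons])
  also have "z # Lb # x @ y \<preceq> Lb # z # x @ y"
    using swap_le_head by (cases z) auto
  finally show ?case by simp
qed simp

lemma move_a_back: "La # x @ y \<preceq> x @ La # y"
proof (induction x)
  case (Cons z x)
  have "La # z # x @ y \<preceq> z # La # x @ y"
    using swap_le_head by (cases z) auto
  also have "z # La # x @ y \<preceq> z # x @ La # y"
    by (rule swap_le_Cons[OF Cons])
  finally show ?case by simp
qed simp

lemma length_rows: "length (rows u) = count_list u Lb"
  by (induction u rule: rows.induct) auto

lemma rows_le: "k \<in> set (rows u) \<Longrightarrow> k \<le> count_list u La"
  by (induction u rule: rows.induct) force+

lemma rows_sorted: "sorted_wrt (\<ge>) (rows u)"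
  by (induction u rule: rows.induct) (auto dest: rows_le)

lemma rows_append: "rows (u @ v) = map (\<lambda>k. k + count_list v La) (rows u) @ rows v"
  by (induction u rule: rows.induct) auto

lemma rows_no_b: "Lb \<notin> set u \<Longrightarrow> rows u = []"
  by (induction u rule: rows.induct) auto

lemma list_all2_le_refl: "list_all2 (\<le>) xs (xs :: nat list)"
  by (simp add: list.rel_refl)

lemma swaps_rows:
  assumes "(u, v) \<in> swaps"
  shows "list_all2 (\<le>) (rows u) (rows v)" "sum_list (rows v) = Suc (sum_list (rows u))"
proof -
  from assms obtain x y where uv: "u = x @ [La, Lb] @ y" "v = x @ [Lb, La] @ y"
    by (auto simp: swaps_def)
  show "list_all2 (\<le>) (rows u) (rows v)" "sum_list (rows v) = Suc (sum_list (rows u))"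
    unfolding uv
    by (auto simp: rows_append intro!: list_all2_appendI list_all2_le_refl)
qed

text \<open>Induction on the upper word. A common first letter can be dropped. If only the upper word starts
  with \<open>b\<close>, then the lower one is \<open>xby\<close> with \<open>x\<close> free of \<open>b\<close>;
  it lies below \<open>bxy\<close>, and \<open>xy\<close> has the parts of \<open>y\<close>, so the induction
  hypothesis applies after dropping the first letter \<open>b\<close>.\<close>

lemma rows_reflect:
  assumes "u \<in> words p q" "v \<in> words p q" "list_all2 (\<le>) (rows u) (rows v)"
  shows "u \<preceq> v"
  using assms
proof (induction v arbitrary: u p q)
  case Nil
  then show ?case using length_words[of u p q] by simp
next
  case (Cons z v)
  show ?case
  proof (cases z)
    case La
    then obtain p' where p: "p = Suc p'" "v \<in> words p' q"
      using Cons.prems by auto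
    (* All p letters a would be behind an initial b of u, more than v contains. *)
    have "hd u \<noteq> Lb" if "u \<noteq> []"
    proof
      assume "hd u = Lb"
      with that obtain u' where u: "u = Lb # u'" by (cases u) auto
      then obtain k l where "rows v = k # l" "p \<le> k"
        using Cons.prems La by (auto simp: words_def list_all2_Cons1)
      then show False
        using rows_le[of k v] p by (auto simp: words_def)
    qed
    then obtain u' where u: "u = La # u'"
      using Cons.prems(1) p by (cases u) auto
    have "u' \<preceq> v"
      by (rule Cons.IH[of _ p' q]) (use Cons.prems u p La in auto)
    then show ?thesis
      unfolding u La by (rule swap_le_Cons)
  next
    case Lb
    then obtain q' where q: "q = Suc q'" "v \<in> words p q'"
      using Cons.prems by auto
    have "Lb \<in> set u"
      using Cons.prems(1) q by (auto simp: words_def intro: ccontr)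
    then obtain x y where u: "u = x @ Lb # y" "Lb \<notin> set x"
      by (auto dest: split_list_first)
    have "x @ y \<preceq> v"
    proof (rule Cons.IH[of _ p q'])
      show "x @ y \<in> words p q'"
        using Cons.prems(1) u q by (auto simp: words_def)
      show "list_all2 (\<le>) (rows (x @ y)) (rows v)"
        using Cons.prems(3) u Lb by (simp add: rows_append rows_no_b)
    qed (rule q)
    then have "Lb # x @ y \<preceq> Lb # v"
      by (rule swap_le_Cons)
    with move_b_front[of x y] show ?thesis
      unfolding u Lb by (rule rtrancl_trans)
  qed
qed

text \<open>Comparison of parts is compatible with adding and removing letters at the front, which makes
  the reflexive transitive closure of the swaps accessible to recursion on words.\<close>

lemma swap_le_iff_rows:
  "u \<preceq> v \<longleftrightarrow> (\<exists>p q. u \<in> words p q \<and> v \<in> words p q) \<and> list_all2 (\<le>) (rows u) (rows v)"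
proof
  assume uv: "u \<preceq> v"
  then have "list_all2 (\<le>) (rows u) (rows v)"
    by (induction rule: rtrancl_induct)
      (auto intro: list_all2_le_refl list_all2_trans[of "(\<le>)" "(\<le>)", OF order_trans] swaps_rows)
  moreover have "u \<in> words (count_list u La) (count_list u Lb)"
    by (simp add: words_def)
  ultimately show "(\<exists>p q. u \<in> words p q \<and> v \<in> words p q) \<and> list_all2 (\<le>) (rows u) (rows v)"
    using swap_le_words[OF uv] by blast
qed (auto intro: rows_reflect)

lemma count_list_replicate: "count_list (replicate k x) y = (if x = y then k else 0)"
  by (induction k) auto

lemma least_word_in: "replicate p La @ replicate q Lb \<in> words p q"
  by (simp add: words_def count_list_replicate)

lemma rows_least_word: "rows (replicate p La @ replicate q Lb) = replicate q 0"
proof -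
  have "rows (replicate q Lb) = replicate q 0"
    by (induction q) (auto simp: count_list_replicate)
  then show ?thesis
    by (simp add: rows_append rows_no_b)
qed

lemma least_word:
  assumes "u \<in> words p q"
  shows "replicate p La @ replicate q Lb \<preceq> u"
proof (rule rows_reflect[OF least_word_in assms])
  have "length (rows u) = q"
    using assms by (simp add: length_rows words_def)
  then show "list_all2 (\<le>) (rows (replicate p La @ replicate q Lb)) (rows u)"
    by (simp add: rows_least_word list_all2_conv_all_nth)
qed

section \<open>Words of the paths on a snake graph\<close>

text \<open>On the snake graph of shape \<open>s\<close> the lowest path starts with a right step, ends with an
  up step, and in between follows the shape; the highest path has the first and the last step
  exchanged.\<close>

definition between :: "word \<Rightarrow> word \<Rightarrow> bool" where
  "between s u \<longleftrightarrow> La # s @ [Lb] \<preceq> u \<and> u \<preceq> Lb # s @ [La]"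

lemma between_iff:
  "between s u \<longleftrightarrow> u \<in> words (Suc (count_list s La)) (Suc (count_list s Lb)) \<and>
     list_all2 (\<le>) (rows (s @ [Lb])) (rows u) \<and>
     list_all2 (\<le>) (rows u) (Suc (count_list s La) # rows (s @ [La]))"
  by (auto simp: between_def swap_le_iff_rows) (auto simp: words_def)

lemma rows_ConsD: "rows u = k # l \<Longrightarrow> k \<le> count_list u La"
  using rows_le[of k u] by simp

lemma between_Nil: "between [] u \<longleftrightarrow> u \<in> words 1 1"
proof -
  have "length (rows u) = 1" "\<And>k. k \<in> set (rows u) \<Longrightarrow> k \<le> 1" if "u \<in> words 1 1"
    using that rows_le[of _ u] by (auto simp: length_rows words_def)
  then show ?thesis
    by (auto simp: between_iff length_Suc_conv)
qed

text \<open>These rules mirror how a path passes the first tile when the second one lies in direction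
  \<open>x\<close>. A step in direction \<open>x\<close> leads to the south-west corner of the second tile. After a step in
  the other direction only \<open>x\<close> can follow, and the path then arrives at the point of the second tile
  that it would have reached from that corner by the step \<open>flip x\<close>.
  In terms of parts, the only inequality that is not immediate bounds the first part
  by the number of letters \<open>a\<close>.\<close>

lemma between_same: "between (x # s) (x # u) \<longleftrightarrow> between s u"
  using rows_ConsD[of u] rows_ConsD[of "s @ [Lb]"]
  by (cases x) (auto simp: between_iff list_all2_Cons2 words_def)

lemma between_turn: "between (x # s) (flip x # x # z) \<longleftrightarrow> between s (flip x # z)"
  using rows_ConsD[of z] rows_ConsD[of "s @ [Lb]"]
  by (cases x) (auto simp: between_iff list_all2_Cons2 words_def)

lemma not_between: "\<not> between (x # s) (flip x # flip x # z)"
  by (cases x) (auto simp: between_iff list_all2_Cons1 words_def rows_append dest!: rows_ConsD)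


section \<open>Snake graphs and their orbits\<close>

lemma snake_of_shape_inject [simp]: "snake_of_shape u = snake_of_shape v \<longleftrightarrow> u = v"
  using shape_snake_of_shape by metis

lemma snake_graphs_eq: "snake_graphs (Suc m) = snake_of_shape ` {u. length u = m}"
proof
  show "snake_graphs (Suc m) \<subseteq> snake_of_shape ` {u. length u = m}"
  proof
    fix T assume T: "T \<in> snake_graphs (Suc m)"
    then have "T = snake_of_shape (shape T)"
      by (simp add: snake_of_shape_shape)
    moreover from this have "length T = Suc (length (shape T))"
      using length_walk[of "(0, 0)" "shape T"] by (simp add: snake_of_shape_def)
    ultimately show "T \<in> snake_of_shape ` {u. length u = m}"
      using T by (auto simp: snake_graphs_def)
  qed
qed (auto simp: snake_of_shape_in)

lemma swap_up_eq:
  "swap_up (Suc m) = {(snake_of_shape u, snake_of_shape v) | u v. (u, v) \<in> swaps \<and> length u = m}"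
proof (intro equalityI subrelI)
  fix T T' assume "(T, T') \<in> swap_up (Suc m)"
  then obtain x y where "T = snake_of_shape (x @ [La, Lb] @ y)" "T' = snake_of_shape (x @ [Lb, La] @ y)"
    "length (x @ [La, Lb] @ y) = m"
    unfolding swap_up_def snake_graphs_eq by (auto simp: shape_snake_of_shape)
  moreover have "(x @ [La, Lb] @ y, x @ [Lb, La] @ y) \<in> swaps"
    unfolding swaps_def by blast
  ultimately show "(T, T') \<in> {(snake_of_shape u, snake_of_shape v) | u v. (u, v) \<in> swaps \<and> length u = m}"
    by blast
next
  fix T T' assume "(T, T') \<in> {(snake_of_shape u, snake_of_shape v) | u v. (u, v) \<in> swaps \<and> length u = m}"
  then obtain x y where "T = snake_of_shape (x @ [La, Lb] @ y)" "T' = snake_of_shape (x @ [Lb, La] @ y)"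
    "m = Suc (Suc (length x + length y))"
    unfolding swaps_def by auto
  then show "(T, T') \<in> swap_up (Suc m)"
    unfolding swap_up_def snake_graphs_eq by (auto simp: shape_snake_of_shape)
qed

lemma swap_up_rtrancl:
  "(snake_of_shape u, T) \<in> (swap_up (Suc (length u)))\<^sup>* \<longleftrightarrow> (\<exists>v. T = snake_of_shape v \<and> u \<preceq> v)"
proof
  assume "(snake_of_shape u, T) \<in> (swap_up (Suc (length u)))\<^sup>*"
  then show "\<exists>v. T = snake_of_shape v \<and> u \<preceq> v"
    by (induction rule: rtrancl_induct) (auto simp: swap_up_eq intro: rtrancl_into_rtrancl)
next
  have "(snake_of_shape u, snake_of_shape v) \<in> (swap_up (Suc (length u)))\<^sup>* \<and> length v = length u"
    if "u \<preceq> v" for v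
    using that
  proof (induction rule: rtrancl_induct)
    case (step v v')
    then have "(snake_of_shape v, snake_of_shape v') \<in> swap_up (Suc (length u))"
      by (auto simp: swap_up_eq)
    moreover have "length v' = length v"
      using step(2) by (auto simp: swaps_def)
    ultimately show ?case
      using step(3) by (auto intro: rtrancl_into_rtrancl)
  qed simp
  then show "\<exists>v. T = snake_of_shape v \<and> u \<preceq> v \<Longrightarrow> (snake_of_shape u, T) \<in> (swap_up (Suc (length u)))\<^sup>*"
    by blast
qed

text \<open>The number of letters \<open>b\<close> is invariant, and two words with the same numbers of letters are
  connected through the least such word, which lies below both.\<close>

lemma same_orbit_iff:
  "(snake_of_shape u, T) \<in> same_orbit (Suc (length u)) \<longleftrightarrow>
     (\<exists>v. T = snake_of_shape v \<and> length v = length u \<and> count_list v Lb = count_list u Lb)"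
proof
  let ?R = "swap_up (Suc (length u))"
  have inv: "length x = length y \<and> count_list x Lb = count_list y Lb" if "(x, y) \<in> swaps" for x y
    using that by (auto simp: swaps_def)
  have "\<exists>v. T' = snake_of_shape v \<and> length v = length u \<and> count_list v Lb = count_list u Lb"
    if "(snake_of_shape u, T') \<in> (?R \<union> ?R\<inverse>)\<^sup>*" for T'
    using that
  proof (induction rule: rtrancl_induct)
    case (step T1 T2)
    then obtain x y where "T1 = snake_of_shape x" "T2 = snake_of_shape y" "(x, y) \<in> swaps \<or> (y, x) \<in> swaps"
      by (auto simp: swap_up_eq)
    with step(3) show ?case
      using inv by fastforce
  qed simp
  then show "(snake_of_shape u, T) \<in> same_orbit (Suc (length u)) \<Longrightarrow>
      \<exists>v. T = snake_of_shape v \<and> length v = length u \<and> count_list v Lb = count_list u Lb"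
    by (auto simp: same_orbit_def)
next
  assume "\<exists>v. T = snake_of_shape v \<and> length v = length u \<and> count_list v Lb = count_list u Lb"
  then obtain v where T: "T = snake_of_shape v" and v: "length v = length u"
    "count_list v Lb = count_list u Lb" by auto
  let ?R = "swap_up (Suc (length u))"
  define p q where "p = count_list u La" and "q = count_list u Lb"
  have u: "u \<in> words p q" by (simp add: words_def p_def q_def)
  have v': "v \<in> words p q" using v length_words[OF u] by (simp add: in_words_iff q_def)
  let ?M = "replicate p La @ replicate q Lb"
  have "length ?M = length u" using length_words[OF u] by simp
  then have "(snake_of_shape ?M, snake_of_shape x) \<in> ?R\<^sup>*" if "x \<in> words p q" for x
    using swap_up_rtrancl[of ?M "snake_of_shape x"] least_word[OF that] by auto
  then have M: "(snake_of_shape ?M, snake_of_shape u) \<in> ?R\<^sup>*" "(snake_of_shape ?M, snake_of_shape v) \<in> ?R\<^sup>*"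
    using u v' by blast+
  have "(snake_of_shape u, snake_of_shape ?M) \<in> (?R\<inverse>)\<^sup>*"
    using M(1) by (rule rtrancl_converseI)
  then have "(snake_of_shape u, snake_of_shape ?M) \<in> (?R \<union> ?R\<inverse>)\<^sup>*"
    by (rule rtrancl_mono[THEN subsetD, rotated]) blast
  moreover have "(snake_of_shape ?M, snake_of_shape v) \<in> (?R \<union> ?R\<inverse>)\<^sup>*"
    using M(2) by (rule rtrancl_mono[THEN subsetD, rotated]) blast
  ultimately have "(snake_of_shape u, snake_of_shape v) \<in> (?R \<union> ?R\<inverse>)\<^sup>*"
    by (rule rtrancl_trans)
  moreover have "snake_of_shape v \<in> snake_graphs (Suc (length u))"
    using snake_of_shape_in[of v] v by simp
  ultimately show "(snake_of_shape u, T) \<in> same_orbit (Suc (length u))"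
    unfolding same_orbit_def T using snake_of_shape_in[of u] by blast
qed

lemma O_orbit_eq: "O_orbit (Suc (p + q)) q = snake_of_shape ` words p q"
proof -
  let ?M = "replicate p La @ replicate q Lb"
  have M: "length ?M = p + q" "count_list ?M Lb = q"
    by (simp_all add: count_list_replicate)
  have "(snake_of_shape ?M, T) \<in> same_orbit (Suc (p + q)) \<longleftrightarrow> T \<in> snake_of_shape ` words p q" for T
    unfolding same_orbit_iff[of ?M T, unfolded M] image_iff Bex_def in_words_iff by blast
  moreover have "G_minus (Suc (p + q)) q = snake_of_shape ?M"
    by (simp add: G_minus_def)
  ultimately show ?thesis
    by (intro set_eqI) (simp only: O_orbit_def Image_singleton_iff)
qed

lemma O_poset_iff:
  "(T, T') \<in> O_poset (Suc (p + q)) q \<longleftrightarrow>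
     (\<exists>u v. T = snake_of_shape u \<and> T' = snake_of_shape v \<and> u \<in> words p q \<and> u \<preceq> v)"
proof -
  have le: "(snake_of_shape u, T') \<in> (swap_up (Suc (p + q)))\<^sup>* \<longleftrightarrow> (\<exists>v. T' = snake_of_shape v \<and> u \<preceq> v)"
    if "u \<in> words p q" for u
    using swap_up_rtrancl[of u T'] length_words[OF that] by simp
  have "(T, T') \<in> O_poset (Suc (p + q)) q \<longleftrightarrow>
      T \<in> snake_of_shape ` words p q \<and> T' \<in> snake_of_shape ` words p q \<and> (T, T') \<in> (swap_up (Suc (p + q)))\<^sup>*"
    by (auto simp: O_poset_def generated_order_def O_orbit_eq)
  also have "\<dots> \<longleftrightarrow> (\<exists>u v. T = snake_of_shape u \<and> T' = snake_of_shape v \<and> u \<in> words p q \<and> u \<preceq> v)"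
    using le swap_le_words by blast
  finally show ?thesis .
qed


section \<open>Lattice paths as words\<close>

text \<open>A step in direction \<open>x\<close> starting at \<open>r\<close> runs along one of the two edges of a tile
  \<open>t\<close> that are parallel to \<open>x\<close>; these start at \<open>t\<close> and at
  \<open>step (flip x) t\<close>.\<close>

fun edge_walk :: "point set \<Rightarrow> point \<Rightarrow> word \<Rightarrow> bool" where
  "edge_walk S r [] \<longleftrightarrow> True"
| "edge_walk S r (x # u) \<longleftrightarrow> (\<exists>t\<in>S. r = t \<or> r = step (flip x) t) \<and> edge_walk S (step x r) u"

lemma edge_in_tile_edges: "{r, step x r} \<in> tile_edges t \<longleftrightarrow> r = t \<or> r = step (flip x) t"
  by (cases r; cases t; cases x)
    (auto simp: tile_edges_def SW_def SE_def NW_def NE_def doubleton_eq_iff)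

lemma step_eq_iff [simp]: "step x r = step y r \<longleftrightarrow> x = y"
  by (cases x; cases y; simp)

lemma edge_walk_iff:
  "successively (\<lambda>p q. unit_step p q \<and> {p, q} \<in> \<Union>(tile_edges ` S)) (walk r u) \<longleftrightarrow> edge_walk S r u"
proof (induction u arbitrary: r)
  case (Cons x u)
  have "unit_step r (step x r)"
    by (cases x) (auto simp: unit_step_def)
  moreover have "{r, step x r} \<in> \<Union>(tile_edges ` S) \<longleftrightarrow> (\<exists>t\<in>S. r = t \<or> r = step (flip x) t)"
    by (simp only: UN_iff edge_in_tile_edges)
  ultimately show ?case
    by (simp only: walk.simps successively_Cons hd_walk walk_not_Nil Cons edge_walk.simps) blast
qed simp

lemma last_walk: "last (walk r u) = (fst r + int (count_list u La), snd r + int (count_list u Lb))"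
proof (induction u arbitrary: r)
  case (Cons x u)
  then show ?case by (cases x; cases r) simp_all
qed simp

lemma lattice_paths_eq:
  "lattice_paths S (int p, int q) = snake_of_shape ` {u \<in> words p q. edge_walk S (0, 0) u}"
proof -
  have iff: "snake_of_shape u \<in> lattice_paths S (int p, int q) \<longleftrightarrow> u \<in> words p q \<and> edge_walk S (0, 0) u" for u
    unfolding lattice_paths_def snake_of_shape_def mem_Collect_eq edge_walk_iff
    by (auto simp: last_walk words_def)
  have "L \<in> range snake_of_shape" if "L \<in> lattice_paths S (int p, int q)" for L
    using path_snake_id[OF that] unfolding path_snake_def by (rule range_eqI[OF sym])
  then show ?thesis
    using iff by blast
qed

lemma walk_append: "walk r (u @ v) = butlast (walk r u) @ walk (last (walk r u)) v"
  by (induction u arbitrary: r) auto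

lemma edge_walk_append: "edge_walk S r (u @ v) \<longleftrightarrow> edge_walk S r u \<and> edge_walk S (last (walk r u)) v"
  by (induction u arbitrary: r) auto

lemma steps_append: "steps (xs @ q # ys) = steps (xs @ [q]) @ steps (q # ys)"
  by (induction xs rule: steps.induct) auto

lemma step_commute: "step x (step y r) = step y (step x r)"
  by (cases x; cases y; cases r) auto

text \<open>A swap in the word of a path moves it across some unit square, and the point is that this square is
  a tile. Since the edges around its south-west corner \<open>t\<close> are available, either \<open>t\<close> is a tile or both
  its left and its lower neighbour are; the assumption turns the second case into the first.\<close>

lemma tile_move_eq:
  assumes S: "\<And>t t1 t2. t1 \<in> S \<Longrightarrow> t2 \<in> S \<Longrightarrow> t = step La t1 \<Longrightarrow> t = step Lb t2 \<Longrightarrow> t \<in> S"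
  shows "tile_move S (int p, int q) = Restr (swap_up (Suc (p + q))) (lattice_paths S (int p, int q))"
    (is "_ = Restr _ ?P")
proof (intro equalityI subrelI)
  fix L1 L2 assume "(L1, L2) \<in> tile_move S (int p, int q)"
  then obtain xs t ys where L: "L1 \<in> ?P" "L2 \<in> ?P"
      and L1: "L1 = xs @ [SW t, SE t, NE t] @ ys" and L2: "L2 = xs @ [SW t, NW t, NE t] @ ys"
    unfolding tile_move_def by blast
  have "steps L1 = steps (xs @ [t]) @ [La, Lb] @ steps (NE t # ys)"
    "steps L2 = steps (xs @ [t]) @ [Lb, La] @ steps (NE t # ys)"
    unfolding L1 L2 using steps_append[of xs t "SE t # NE t # ys"] steps_append[of xs t "NW t # NE t # ys"]
    by (auto simp: SW_def SE_def NW_def NE_def step_commute[of La Lb])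
  then have sw: "(steps L1, steps L2) \<in> swaps"
    unfolding swaps_def by blast
  obtain u v where u: "L1 = snake_of_shape u" "u \<in> words p q" and v: "L2 = snake_of_shape v"
    using L unfolding lattice_paths_eq by blast
  have "(u, v) \<in> swaps"
    using sw by (simp add: u v snake_of_shape_def)
  then have "(L1, L2) \<in> swap_up (Suc (p + q))"
    using length_words[OF u(2)] u(1) v unfolding swap_up_eq by blast
  with L show "(L1, L2) \<in> Restr (swap_up (Suc (p + q))) ?P"
    by blast
next
  fix L1 L2 assume "(L1, L2) \<in> Restr (swap_up (Suc (p + q))) ?P"
  then obtain u v where L: "L1 \<in> ?P" "L2 \<in> ?P"
    and L1: "L1 = snake_of_shape (u @ [La, Lb] @ v)" and L2: "L2 = snake_of_shape (u @ [Lb, La] @ v)"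
    unfolding swap_up_eq swaps_def by blast
  define t where "t = last (walk (0, 0) u)"
  have "edge_walk S (0, 0) (u @ [La, Lb] @ v)" "edge_walk S (0, 0) (u @ [Lb, La] @ v)"
    using L unfolding L1 L2 lattice_paths_eq by (simp_all add: image_iff)
  then have "\<exists>t'\<in>S. t = t' \<or> t = step Lb t'" "\<exists>t'\<in>S. t = t' \<or> t = step La t'"
    unfolding edge_walk_append t_def by simp_all
  then have "t \<in> S"
    using S by blast
  moreover have "walk (step Lb (step La t)) v = NE t # tl (walk (step Lb (step La t)) v)"
    by (cases v) (auto simp: NE_def step_commute[of La Lb])
  then have "L1 = butlast (walk (0, 0) u) @ [SW t, SE t, NE t] @ tl (walk (NE t) v)"
      "L2 = butlast (walk (0, 0) u) @ [SW t, NW t, NE t] @ tl (walk (NE t) v)"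
    unfolding L1 L2 snake_of_shape_def walk_append
    by (simp_all add: t_def[symmetric] SW_def SE_def NW_def NE_def step_commute[of La Lb])
  ultimately show "(L1, L2) \<in> tile_move S (int p, int q)"
    using L unfolding tile_move_def by blast
qed

text \<open>A chain between two elements of a convex set never leaves it. For the set of paths on a snake
  graph this shows that the moves available there generate the order induced from the orbit.\<close>

lemma generated_order_Restr_convex:
  assumes "\<And>x y z. x \<in> A \<Longrightarrow> z \<in> A \<Longrightarrow> (x, y) \<in> R\<^sup>* \<Longrightarrow> (y, z) \<in> R\<^sup>* \<Longrightarrow> y \<in> A"
  shows "generated_order A (Restr R A) = generated_order A R"
proof -
  have "(x, z) \<in> (Restr R A)\<^sup>*" if "(x, z) \<in> R\<^sup>*" "x \<in> A" "z \<in> A" for x z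
    using that
  proof (induction rule: converse_rtrancl_induct)
    case (step x y)
    then have "y \<in> A" using assms[of x z y] by blast
    with step show ?case by (auto intro: converse_rtrancl_into_rtrancl)
  qed simp
  then show ?thesis
    using rtrancl_mono[of "Restr R A" R] by (auto simp: generated_order_def)
qed

section \<open>Grids and snake graphs\<close>

text \<open>On the upper or right boundary of the grid the point itself is no tile, and the edge belongs to
  the tile below it or to its left.\<close>

lemma grid_edge_walk:
  assumes "p \<ge> 1" "q \<ge> 1" "fst r \<ge> 0" "snd r \<ge> 0"
    "fst r + int (count_list u La) \<le> int p" "snd r + int (count_list u Lb) \<le> int q"
  shows "edge_walk ({0..<int p} \<times> {0..<int q}) r u"
  using assms
proof (induction u arbitrary: r)
  case (Cons x u)
  obtain i j where r: "r = (i, j)" by (cases r)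
  show ?case
  proof (cases x)
    case La
    have "\<exists>t\<in>{0..<int p} \<times> {0..<int q}. r = t \<or> r = step Lb t"
      using Cons.prems r La by (intro bexI[of _ "if j < int q then r else (i, j - 1)"]) auto
    moreover have "edge_walk ({0..<int p} \<times> {0..<int q}) (step x r) u"
      using Cons.prems r La by (intro Cons.IH) auto
    ultimately show ?thesis using La by simp
  next
    case Lb
    have "\<exists>t\<in>{0..<int p} \<times> {0..<int q}. r = t \<or> r = step La t"
      using Cons.prems r Lb by (intro bexI[of _ "if i < int p then r else (i - 1, j)"]) auto
    moreover have "edge_walk ({0..<int p} \<times> {0..<int q}) (step x r) u"
      using Cons.prems r Lb by (intro Cons.IH) auto
    ultimately show ?thesis using Lb by simp
  qed
qed simp

lemma grid_poset_eq:
  assumes "p \<ge> 1" "q \<ge> 1"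
  shows "grid_poset p q = O_poset (Suc (p + q)) q"
proof -
  let ?S = "{0..<int p} \<times> {0..<int q}"
  have "edge_walk ?S (0, 0) u" if "u \<in> words p q" for u
    using that by (intro grid_edge_walk assms) (simp_all add: words_def)
  then have paths: "lattice_paths ?S (int p, int q) = O_orbit (Suc (p + q)) q"
    unfolding lattice_paths_eq O_orbit_eq by blast
  have moves: "tile_move ?S (int p, int q) = Restr (swap_up (Suc (p + q))) (lattice_paths ?S (int p, int q))"
  proof (rule tile_move_eq)
    fix t t1 t2 assume "t1 \<in> ?S" "t2 \<in> ?S" "t = step La t1" "t = step Lb t2"
    then show "t \<in> ?S" by (cases t1; cases t2) simp
  qed
  have "grid_poset p q = generated_order (lattice_paths ?S (int p, int q)) (tile_move ?S (int p, int q))"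
    unfolding grid_poset_def path_poset_def ..
  also have "\<dots> = O_poset (Suc (p + q)) q"
    unfolding moves paths by (rule O_poset_restrict[symmetric])
  finally show ?thesis .
qed

lemma walk_above: "t \<in> set (walk r s) \<Longrightarrow> fst r \<le> fst t \<and> snd r \<le> snd t"
proof (induction s arbitrary: r)
  case (Cons x s)
  then show ?case by (cases x; cases r) force+
qed simp

text \<open>Each tile of a snake graph lies one antidiagonal further than the one before. So no square can have both
  its left and its lower neighbour in the graph, and \<open>tile_move_eq\<close> applies.\<close>

lemma walk_antidiagonal:
  "t \<in> set (walk r s) \<Longrightarrow> t' \<in> set (walk r s) \<Longrightarrow> fst t + snd t = fst t' + snd t' \<Longrightarrow> t = t'"
proof (induction s arbitrary: r)
  case (Cons x s)
  have lt: "fst r + snd r < fst t + snd t" if "t \<in> set (walk (step x r) s)" for t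
    using walk_above[OF that] by (cases x; cases r) auto
  have "t = r \<or> t \<in> set (walk (step x r) s)" "t' = r \<or> t' \<in> set (walk (step x r) s)"
    using Cons.prems(1,2) by simp_all
  then show ?case
    using lt[of t] lt[of t'] Cons.prems(3) Cons.IH[of "step x r"] by (elim disjE) simp_all
qed simp

text \<open>A path that has passed the first tile \<open>p\<close> could use \<open>p\<close> only for the edges leading
  to its north-east corner. The one starting at \<open>step x p\<close> also belongs to the next tile, which sits there,
  and the start of the other one is excluded.\<close>

lemma edge_walk_insert:
  assumes "step x p \<in> S" "fst p + snd p < fst r + snd r" "r \<noteq> step (flip x) p"
  shows "edge_walk (insert p S) r u \<longleftrightarrow> edge_walk S r u"
  using assms(2-)
proof (induction u arbitrary: r)
  case (Cons y u)
  have "edge_walk (insert p S) (step y r) u \<longleftrightarrow> edge_walk S (step y r) u"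
    using Cons.prems by (intro Cons.IH) (cases y; cases r; cases p; cases x; auto)+
  moreover have "(r = p \<or> r = step (flip y) p) \<Longrightarrow> r \<in> S"
    using Cons.prems assms(1) by (cases y; cases x; cases p) auto
  ultimately show ?case by auto
qed simp

text \<open>Induction along the snake graph, the first step of the path being compared with the direction
  \<open>x\<close> of the second tile; the cases are those of \<open>between_same\<close>, \<open>between_turn\<close> and
  \<open>not_between\<close>.\<close>

lemma snake_edge_walk:
  assumes "u \<in> words (Suc (count_list s La)) (Suc (count_list s Lb))"
  shows "edge_walk (set (walk r s)) r u \<longleftrightarrow> between s u"
  using assms
proof (induction s arbitrary: r u)
  case Nil
  have "edge_walk {r} r u"
  proof -
    from Nil have "length u = 2" by (simp add: in_words_iff)
    then obtain x y where "u = [x, y]" by (auto simp: numeral_2_eq_2 length_Suc_conv)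
    with Nil show ?thesis by (cases x; cases y) (auto simp: words_def)
  qed
  with Nil show ?case by (simp add: between_Nil)
next
  case (Cons x s)
  let ?S = "set (walk (step x r) s)"
  have hd: "step x r \<in> ?S" by (cases s) auto
  from Cons.prems obtain y u' where u: "u = y # u'" by (cases u) auto
  show ?case
  proof (cases "y = x")
    case True
    have "edge_walk (insert r ?S) (step x r) u' \<longleftrightarrow> edge_walk ?S (step x r) u'"
      by (rule edge_walk_insert[OF hd]) (cases x; cases r; simp)+
    moreover have "edge_walk ?S (step x r) u' \<longleftrightarrow> between s u'"
      using Cons.prems u True by (intro Cons.IH) (cases x; auto)
    ultimately show ?thesis
      by (simp add: u True between_same)
  next
    case False
    then have y: "y = flip x" by (cases x; cases y) auto
    from Cons.prems obtain z u'' where u': "u' = z # u''" by (cases u'; cases y; cases x) (auto simp: u)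
    show ?thesis
    proof (cases "z = x")
      case True
      have "edge_walk (insert r ?S) (step x (step y r)) u'' \<longleftrightarrow> edge_walk ?S (step x (step y r)) u''"
        by (rule edge_walk_insert[OF hd]) (cases x; cases r; simp add: y)+
      moreover have "edge_walk ?S (step x r) (y # u'') \<longleftrightarrow> between s (y # u'')"
        using Cons.prems u u' True y by (intro Cons.IH) (cases x; auto)
      ultimately show ?thesis
        using hd by (auto simp: u u' True between_turn y step_commute[of _ "flip x"])
    next
      case False
      then have z: "z = flip x" by (cases x; cases z) auto
      (* Two steps away from direction x leave the graph: the first tile has no such edge, and all
         later tiles are further in direction x than the point reached after the first step. *)
      have "step y r \<noteq> t \<and> step y r \<noteq> step x t" if "t \<in> insert r ?S" for t
        using that walk_above[of t "step x r" s] by (cases x; cases r; cases t) (auto simp: y)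
      then show ?thesis
        by (auto simp: u u' z y not_between)
    qed
  qed
qed

lemma snake_paths_eq:
  "lattice_paths (set (snake_of_shape s)) (NE (last (snake_of_shape s))) = snake_of_shape ` {u. between s u}"
    (is ?A)
  and snake_NE: "NE (last (snake_of_shape s)) = (int (Suc (count_list s La)), int (Suc (count_list s Lb)))"
    (is ?B)
proof -
  show ?B by (simp add: snake_of_shape_def last_walk NE_def)
  then show ?A
    unfolding \<open>?B\<close> lattice_paths_eq
    using snake_edge_walk[of _ s "(0, 0)"] by (auto simp: snake_of_shape_def between_iff)
qed

text \<open>The paths form the interval by \<open>snake_edge_walk\<close>, and as an interval is convex, the tile moves
  on the graph generate the whole induced order. The two posets are equal and not merely isomorphic,
  because the vertex list of a path is the tile list of the snake graph with the same word.\<close>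

lemma snake_path_poset_eq:
  fixes s :: word
  defines "p \<equiv> Suc (count_list s La)" and "q \<equiv> Suc (count_list s Lb)"
  shows "path_poset (set (snake_of_shape s)) (NE (last (snake_of_shape s))) =
    closed_interval (O_poset (Suc (p + q)) q) (snake_of_shape (La # s @ [Lb])) (snake_of_shape (Lb # s @ [La]))"
proof -
  let ?S = "set (snake_of_shape s)" and ?e = "NE (last (snake_of_shape s))" and ?R = "swap_up (Suc (p + q))"
  let ?A = "snake_of_shape ` {u. between s u}"
  have words: "u \<in> words p q" if "between s u" for u
    using that by (simp add: between_iff p_def q_def)
  have le: "(snake_of_shape u, T) \<in> ?R\<^sup>* \<longleftrightarrow> (\<exists>v. T = snake_of_shape v \<and> u \<preceq> v)" if "u \<in> words p q" for u T
    using swap_up_rtrancl[of u T] length_words[OF that] by simp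
  have "tile_move ?S ?e = Restr ?R (lattice_paths ?S ?e)"
    unfolding snake_NE p_def q_def
  proof (rule tile_move_eq)
    fix t t1 t2 assume t: "t1 \<in> ?S" "t2 \<in> ?S" "t = step La t1" "t = step Lb t2"
    then have "t1 = t2"
      unfolding snake_of_shape_def by (intro walk_antidiagonal) (cases t1; cases t2; auto)+
    with t show "t \<in> ?S" by simp
  qed
  then have "path_poset ?S ?e = generated_order ?A (Restr ?R ?A)"
    by (simp add: path_poset_def snake_paths_eq)
  also have "\<dots> = generated_order ?A ?R"
  proof (rule generated_order_Restr_convex)
    fix x y z assume "x \<in> ?A" "z \<in> ?A" and xyz: "(x, y) \<in> ?R\<^sup>*" "(y, z) \<in> ?R\<^sup>*"
    then obtain u v where uv: "x = snake_of_shape u" "z = snake_of_shape v" "between s u" "between s v"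
      by auto
    with xyz le[OF words] obtain u' where u': "y = snake_of_shape u'" "u \<preceq> u'" by auto
    then have "u' \<in> words p q"
      using words uv swap_le_words by blast
    with xyz uv u' have "u' \<preceq> v" by (auto simp: le)
    with uv u' have "between s u'"
      by (auto simp: between_def)
    with u' show "y \<in> ?A" by simp
  qed
  also have "\<dots> = closed_interval (O_poset (Suc (p + q)) q) (snake_of_shape (La # s @ [Lb])) (snake_of_shape (Lb # s @ [La]))"
  proof -
    have "La # s @ [Lb] \<in> words p q"
      by (auto simp: words_def p_def q_def)
    then have A: "?A = {z. (snake_of_shape (La # s @ [Lb]), z) \<in> O_poset (Suc (p + q)) q \<and>
        (z, snake_of_shape (Lb # s @ [La])) \<in> O_poset (Suc (p + q)) q}"
      using words by (auto simp: O_poset_iff between_def)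
    have "Restr (?R\<^sup>*) ?A = Restr (O_poset (Suc (p + q)) q) ?A"
      using words by (auto simp: le O_poset_iff)
    then show ?thesis
      by (simp add: closed_interval_def generated_order_def A[symmetric])
  qed
  finally show ?thesis .
qed


section \<open>The orbits as unions of snake intervals\<close>

lemma isomorphic_refl: "r \<simeq> r"
  unfolding isomorphic_def by (rule exI[of _ id]) (simp add: iso_iff2)

lemma I_poset_eq: "I_poset w = L_poset w"
proof -
  have id: "path_snake L = L" if "L \<in> Field (L_poset w)" for L
    using that by (simp add: L_poset_def path_poset_def path_snake_id)
  have "I_poset w = id ` L_poset w"
    unfolding I_poset_def by (rule image_cong) (auto simp: id FieldI1 FieldI2)
  then show ?thesis by simp
qed

lemma length_dual: "length (dual w) = length w"
  by (induction w rule: dual.induct) auto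

lemma L_poset_eq:
  assumes "length w = n - 1" "n \<ge> 1"
  shows "L_poset w = closed_interval (O_poset (n + 2) (Suc (count_list (dual w) Lb)))
    (snake_of_shape (La # dual w @ [Lb])) (snake_of_shape (Lb # dual w @ [La]))"
proof -
  have "dual w \<in> words (count_list (dual w) La) (count_list (dual w) Lb)"
    by (simp add: words_def)
  from length_words[OF this]
  have "n + 2 = Suc (Suc (count_list (dual w) La) + Suc (count_list (dual w) Lb))"
    using assms by (simp add: length_dual)
  then show ?thesis
    unfolding L_poset_def G_def by (simp only: snake_path_poset_eq)
qed

lemma least_le_greatest: "La # s @ [Lb] \<preceq> Lb # s @ [La]"
proof -
  have "La # s @ [Lb] \<preceq> Lb # La # s"
    using move_b_front[of "La # s" "[]"] by simp
  also have "Lb # La # s \<preceq> Lb # s @ [La]"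
    using swap_le_Cons[OF move_a_back[of s "[]"]] by simp
  finally show ?thesis .
qed

lemma snake_interval_bounds:
  assumes "length w = n - 1" "n \<ge> 1"
  shows "Suc (count_list (dual w) Lb) \<in> {1..n}" (is ?thesis1)
    and "(snake_of_shape (La # dual w @ [Lb]), snake_of_shape (Lb # dual w @ [La]))
      \<in> O_poset (n + 2) (Suc (count_list (dual w) Lb))" (is ?thesis2)
    and "(snake_of_shape u, snake_of_shape u) \<in> I_poset w \<longleftrightarrow> between (dual w) u" (is ?thesis3)
proof -
  let ?p = "Suc (count_list (dual w) La)" and ?q = "Suc (count_list (dual w) Lb)"
  have "dual w \<in> words (count_list (dual w) La) (count_list (dual w) Lb)"
    by (simp add: words_def)
  from length_words[OF this] have n: "n + 2 = Suc (?p + ?q)"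
    using assms by (simp add: length_dual)
  then show ?thesis1 by simp
  have W: "La # dual w @ [Lb] \<in> words ?p ?q"
    by (simp add: words_def)
  then show ?thesis2
    using least_le_greatest unfolding n O_poset_iff by blast
  have "between (dual w) u \<Longrightarrow> u \<in> words ?p ?q"
    by (simp add: between_iff)
  moreover have "(snake_of_shape v, snake_of_shape v') \<in> O_poset (n + 2) ?q \<longleftrightarrow> v \<in> words ?p ?q \<and> v \<preceq> v'" for v v'
    unfolding n O_poset_iff by simp
  ultimately show ?thesis3
    using W unfolding I_poset_eq L_poset_eq[OF assms] closed_interval_def between_def by auto
qed

text \<open>The least path \<open>asb\<close> fixes the number of letters \<open>b\<close>, and hence the orbit.\<close>

lemma interval_in_O_poset_iff:
  assumes w: "length w = n - 1" "n \<ge> 1" and j: "j \<in> {1..n}"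
  shows "interval_in (I_poset w) (O_poset (n + 2) j) \<longleftrightarrow> j = Suc (count_list (dual w) Lb)"
proof
  assume "interval_in (I_poset w) (O_poset (n + 2) j)"
  then have sub: "I_poset w \<subseteq> O_poset (n + 2) j"
    by (auto simp: interval_in_def closed_interval_def)
  let ?x = "La # dual w @ [Lb]"
  have n: "n + 2 = Suc ((n + 1 - j) + j)" using j by simp
  have "between (dual w) ?x"
    by (simp add: between_def least_le_greatest)
  then have "(snake_of_shape ?x, snake_of_shape ?x) \<in> O_poset (n + 2) j"
    using snake_interval_bounds(3)[OF w] sub by blast
  then have "?x \<in> words (n + 1 - j) j"
    unfolding n O_poset_iff by simp
  then show "j = Suc (count_list (dual w) Lb)"
    by (simp add: words_def)
next
  assume "j = Suc (count_list (dual w) Lb)"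
  then show "interval_in (I_poset w) (O_poset (n + 2) j)"
    using snake_interval_bounds(2)[OF w] unfolding interval_in_def I_poset_eq L_poset_eq[OF w] by blast
qed

lemma mixed_word_factor:
  "La \<in> set u \<Longrightarrow> Lb \<in> set u \<Longrightarrow> \<exists>x y. u = x @ [La, Lb] @ y \<or> u = x @ [Lb, La] @ y"
proof (induction u)
  case (Cons z u)
  show ?case
  proof (cases "La \<in> set u \<and> Lb \<in> set u")
    case True
    with Cons.IH obtain x y where "u = x @ [La, Lb] @ y \<or> u = x @ [Lb, La] @ y" by blast
    then have "z # u = (z # x) @ [La, Lb] @ y \<or> z # u = (z # x) @ [Lb, La] @ y" by simp
    then show ?thesis by blast
  next
    case False
    then obtain t v where "u = t # v" "t = flip z"
      using Cons.prems by (cases u; cases z; cases "hd u") auto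
    then have "z # u = [] @ [z, flip z] @ v" by simp
    then show ?thesis by (cases z) fastforce+
  qed
qed simp

text \<open>If \<open>u\<close> is \<open>xaby\<close> or \<open>xbay\<close>, take \<open>s = xy\<close>: moving the letter
  \<open>a\<close> to the front and \<open>b\<close> to the end goes down to \<open>axyb\<close>, and the opposite moves
  go up to \<open>bxya\<close>.\<close>

lemma exists_between:
  assumes "u \<in> words (Suc p) (Suc q)"
  obtains s where "s \<in> words p q" "between s u"
proof -
  have "La \<in> set u" "Lb \<in> set u"
    using assms count_notin[of _ u] by (fastforce simp: words_def)+
  then obtain x y where u: "u = x @ [La, Lb] @ y \<or> u = x @ [Lb, La] @ y"
    using mixed_word_factor by blast
  have lower: "La # (x @ y) @ [Lb] \<preceq> x @ [La, Lb] @ y"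
  proof -
    have "La # x @ y @ [Lb] \<preceq> x @ La # y @ [Lb]"
      by (rule move_a_back)
    also have "x @ La # y @ [Lb] \<preceq> x @ La # Lb # y"
      using swaps_context[OF move_b_front[of y "[]"], of "x @ [La]" "[]"] by simp
    finally show ?thesis by simp
  qed
  have upper: "x @ [Lb, La] @ y \<preceq> Lb # (x @ y) @ [La]"
  proof -
    have "x @ Lb # La # y \<preceq> Lb # x @ La # y"
      by (rule move_b_front)
    also have "Lb # x @ La # y \<preceq> Lb # x @ y @ [La]"
      using swaps_context[OF move_a_back[of y "[]"], of "Lb # x" "[]"] by simp
    finally show ?thesis by simp
  qed
  have "x @ [La, Lb] @ y \<preceq> x @ [Lb, La] @ y"
    by (rule r_into_rtrancl) (auto simp: swaps_def)
  then have "between (x @ y) u"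
    using u lower upper unfolding between_def by (meson rtrancl_trans)
  moreover have "x @ y \<in> words p q"
    using u assms by (auto simp: words_def)
  ultimately show ?thesis using that by blast
qed

lemma O_orbit_covered:
  assumes j: "j \<in> {1..n}"
  shows "O_orbit (n + 2) j =
    \<Union>{Field (I_poset v) | v. length v = n - 1 \<and> interval_in (I_poset v) (O_poset (n + 2) j)}"
    (is "_ = \<Union>?F")
proof (intro equalityI subsetI)
  fix T assume T: "T \<in> O_orbit (n + 2) j"
  have n: "n + 2 = Suc (Suc (n - j) + Suc (j - 1))" and j': "Suc (j - 1) = j" using j by simp_all
  obtain u where u: "T = snake_of_shape u" "u \<in> words (Suc (n - j)) (Suc (j - 1))"
    using T O_orbit_eq[of "Suc (n - j)" "Suc (j - 1)"] unfolding n j' by blast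
  obtain s where s: "s \<in> words (n - j) (j - 1)" "between s u"
    using exists_between[OF u(2)] .
  have len: "length (dual s) = n - 1"
    using length_words[OF s(1)] j by (simp add: length_dual)
  have "interval_in (I_poset (dual s)) (O_poset (n + 2) j)"
    using interval_in_O_poset_iff[OF len _ j] s(1) j by (simp add: dual_dual words_def)
  moreover have "T \<in> Field (I_poset (dual s))"
    using snake_interval_bounds(3)[OF len, of u] s(2) j u(1) by (auto simp: dual_dual intro: FieldI1)
  ultimately show "T \<in> \<Union>?F"
    using len by blast
next
  fix T assume "T \<in> \<Union>?F"
  then obtain v where v: "T \<in> Field (I_poset v)" "interval_in (I_poset v) (O_poset (n + 2) j)"
    by blast
  then have "Field (I_poset v) \<subseteq> Field (O_poset (n + 2) j)"
    by (intro mono_Field) (auto simp: interval_in_def closed_interval_def)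
  with v(1) show "T \<in> O_orbit (n + 2) j"
    by (auto simp: O_poset_def)
qed

lemma common_orbit_iff:
  assumes "length w1 = n - 1" "length w2 = n - 1" "n \<ge> 1"
  shows "(\<exists>X\<in>orbits n. G w1 \<in> X \<and> G w2 \<in> X) \<longleftrightarrow> count_list (dual w1) Lb = count_list (dual w2) Lb"
proof -
  obtain m where n: "n = Suc m" using assms(3) by (cases n) auto
  have len: "length (dual w1) = m" "length (dual w2) = m"
    using assms n by (simp_all add: length_dual)
  have orb: "(snake_of_shape u, snake_of_shape v) \<in> same_orbit n \<longleftrightarrow> length v = m \<and> count_list v Lb = count_list u Lb"
    if "length u = m" for u v
    using same_orbit_iff[of u "snake_of_shape v"] that unfolding n by auto
  show ?thesis
  proof
    assume "\<exists>X\<in>orbits n. G w1 \<in> X \<and> G w2 \<in> X"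
    then obtain T where "T \<in> snake_graphs n" "(T, G w1) \<in> same_orbit n" "(T, G w2) \<in> same_orbit n"
      unfolding orbits_def quotient_def by blast
    then obtain u where "length u = m" "(snake_of_shape u, G w1) \<in> same_orbit n" "(snake_of_shape u, G w2) \<in> same_orbit n"
      unfolding n snake_graphs_eq by blast
    then show "count_list (dual w1) Lb = count_list (dual w2) Lb"
      by (simp add: G_def orb)
  next
    assume "count_list (dual w1) Lb = count_list (dual w2) Lb"
    then have "G w1 \<in> same_orbit n `` {G w1}" "G w2 \<in> same_orbit n `` {G w1}"
      using len by (simp_all add: G_def orb)
    moreover have "same_orbit n `` {G w1} \<in> orbits n"
      unfolding orbits_def using snake_of_shape_in[of "dual w1"] len n by (intro quotientI) (simp add: G_def)
    ultimately show "\<exists>X\<in>orbits n. G w1 \<in> X \<and> G w2 \<in> X"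
      by blast
  qed
qed


section \<open>The rank generating function\<close>

lemma finite_words: "finite (words p q)"
proof -
  have "finite (UNIV :: letter set)"
    by (rule finite_subset[of _ "{La, Lb}"]) auto
  then have "finite {u :: word. length u = p + q}"
    using finite_lists_length_eq[of "UNIV :: letter set" "p + q"] by simp
  then show ?thesis
    by (rule rev_finite_subset) (auto dest: length_words)
qed

lemma O_poset_rank_function:
  "rank_function (O_poset (Suc (p + q)) q) (\<lambda>T. sum_list (rows (shape T)))"
  unfolding rank_function_def
proof (intro conjI ballI allI impI)
  let ?M = "replicate p La @ replicate q Lb"
  fix T assume T: "T \<in> Field (O_poset (Suc (p + q)) q)"
    "\<forall>z. (z, T) \<in> O_poset (Suc (p + q)) q \<longrightarrow> z = T"
  then obtain u where u: "T = snake_of_shape u" "u \<in> words p q"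
    by (auto simp: O_poset_def O_orbit_eq)
  have "(snake_of_shape ?M, T) \<in> O_poset (Suc (p + q)) q"
    unfolding O_poset_iff using least_word_in least_word[OF u(2)] u(1) by blast
  with T(2) have "snake_of_shape ?M = T" by blast
  then have "shape T = ?M"
    using shape_snake_of_shape by blast
  then show "sum_list (rows (shape T)) = 0"
    by (simp add: rows_least_word)
next
  fix T T' assume "covers (O_poset (Suc (p + q)) q) T T'"
  then have "(T, T') \<in> swap_up (Suc (p + q))"
    by (simp add: O_poset_covers)
  then obtain u v where "T = snake_of_shape u" "T' = snake_of_shape v" "(u, v) \<in> swaps"
    unfolding swap_up_eq by blast
  then show "sum_list (rows (shape T')) = sum_list (rows (shape T)) + 1"
    by (simp add: shape_snake_of_shape swaps_rows(2))
qed

text \<open>Any rank function vanishes at the least element and grows by one along each of the swaps that lead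
  from there to the given word, so the one chosen in \<open>rank\<close> is the size of the partition.\<close>

lemma O_poset_rank:
  assumes "u \<in> words p q"
  shows "rank (O_poset (Suc (p + q)) q) (snake_of_shape u) = sum_list (rows u)"
proof -
  let ?O = "O_poset (Suc (p + q)) q" and ?M = "replicate p La @ replicate q Lb"
  have rf: "rank_function ?O (rank ?O)"
    unfolding rank_def by (rule someI[where P = "rank_function ?O", OF O_poset_rank_function])
  have M: "snake_of_shape ?M \<in> Field ?O"
    using least_word_in by (auto simp: O_poset_def O_orbit_eq)
  have antisym: "antisym ?O"
    using O_poset_partial_order by (auto simp: partial_order_on_def)
  have "z = snake_of_shape ?M" if z: "(z, snake_of_shape ?M) \<in> ?O" for z
  proof -
    obtain v where v: "z = snake_of_shape v" "v \<in> words p q"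
      using z unfolding O_poset_iff by blast
    have "(snake_of_shape ?M, z) \<in> ?O"
      unfolding O_poset_iff using least_word_in least_word[OF v(2)] v(1) by blast
    with z antisym show ?thesis by (blast dest: antisymD)
  qed
  then have base: "rank ?O (snake_of_shape ?M) = 0"
    using rf M unfolding rank_function_def by blast
  have "rank ?O (snake_of_shape u) = sum_list (rows u) \<and> u \<in> words p q"
    using least_word[OF assms]
  proof (induction rule: rtrancl_induct)
    case base
    show ?case using \<open>rank ?O (snake_of_shape ?M) = 0\<close> least_word_in by (simp add: rows_least_word)
  next
    case (step v v')
    have v': "v' \<in> words p q"
      using step swap_le_words[OF r_into_rtrancl] by blast
    have "(snake_of_shape v, snake_of_shape v') \<in> swap_up (Suc (p + q))"
      using step length_words[of v p q] unfolding swap_up_eq by blast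
    then have "covers ?O (snake_of_shape v) (snake_of_shape v')"
      using step v' by (simp add: O_poset_covers O_orbit_eq)
    then have "rank ?O (snake_of_shape v') = rank ?O (snake_of_shape v) + 1"
      using rf unfolding rank_function_def by blast
    with step v' show ?case
      by (simp add: swaps_rows(2))
  qed
  then show ?thesis by simp
qed

lemma graded_O_poset: "graded (O_poset (Suc (p + q)) q)"
proof -
  have F: "Field (O_poset (Suc (p + q)) q) = O_orbit (Suc (p + q)) q"
    by (simp add: O_poset_def)
  show ?thesis
    unfolding graded_def F
  proof (intro conjI exI)
    show "finite (O_orbit (Suc (p + q)) q)"
      by (simp add: O_orbit_eq finite_words)
  qed (rule O_poset_partial_order O_poset_rank_function)+
qed

text \<open>As the words correspond to the partitions in a box with \<open>q\<close> rows and \<open>p\<close> columns, this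
  counts those partitions by size.\<close>

definition gauss_poly :: "nat \<Rightarrow> nat \<Rightarrow> int poly" where
  "gauss_poly p q = (\<Sum>u\<in>words p q. monom 1 (sum_list (rows u)))"

lemma rank_generating_function_O_poset:
  "rank_generating_function (O_poset (Suc (p + q)) q) = gauss_poly p q"
proof -
  have F: "Field (O_poset (Suc (p + q)) q) = snake_of_shape ` words p q"
    by (simp add: O_poset_def O_orbit_eq)
  have inj: "inj_on snake_of_shape (words p q)"
    by (simp add: inj_on_def)
  show ?thesis
    unfolding rank_generating_function_def F sum.reindex[OF inj] gauss_poly_def
    by (rule sum.cong) (simp_all add: O_poset_rank)
qed

lemma words_0: "words p 0 = {replicate p La}" "words 0 q = {replicate q Lb}"
proof -
  have "u = replicate p La" if "u \<in> words p 0" for u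
  proof (rule replicate_eqI)
    show "length u = p" using length_words[OF that] by simp
    have "Lb \<notin> set u"
      using that by (simp add: words_def count_list_0_iff)
    then show "y = La" if "y \<in> set u" for y
      using that by (metis letter.exhaust)
  qed
  then show "words p 0 = {replicate p La}"
    using least_word_in[of p 0] unfolding replicate_0 append_Nil2 by blast
  have "u = replicate q Lb" if "u \<in> words 0 q" for u
  proof (rule replicate_eqI)
    show "length u = q" using length_words[OF that] by simp
    have "La \<notin> set u"
      using that by (simp add: words_def count_list_0_iff)
    then show "y = Lb" if "y \<in> set u" for y
      using that by (metis letter.exhaust)
  qed
  then show "words 0 q = {replicate q Lb}"
    using least_word_in[of 0 q] unfolding replicate_0 append_Nil by blast
qed

lemma gauss_poly_0 [simp]: "gauss_poly p 0 = 1" "gauss_poly 0 q = 1"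
  using rows_least_word[of p 0] rows_least_word[of 0 q]
  by (simp_all add: gauss_poly_def words_0 monom_eq_1 sum_list_replicate)

lemma words_Suc_Suc:
  "words (Suc p) (Suc q) = Cons La ` words p (Suc q) \<union> Cons Lb ` words (Suc p) q"
proof (intro equalityI subsetI)
  fix u assume u: "u \<in> words (Suc p) (Suc q)"
  then obtain x v where "u = x # v" by (cases u) auto
  with u show "u \<in> Cons La ` words p (Suc q) \<union> Cons Lb ` words (Suc p) q"
    by (cases x) auto
qed auto

text \<open>An initial \<open>a\<close> has no influence on the partition, while an initial \<open>b\<close> contributes
  a part of the full length \<open>Suc p\<close>.\<close>

lemma gauss_poly_rec:
  "gauss_poly (Suc p) (Suc q) = gauss_poly p (Suc q) + monom 1 (Suc p) * gauss_poly (Suc p) q"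
proof -
  have a: "(\<Sum>u\<in>Cons La ` words p (Suc q). monom 1 (sum_list (rows u))) = gauss_poly p (Suc q)"
    unfolding gauss_poly_def by (subst sum.reindex) simp_all
  have "(\<Sum>u\<in>Cons Lb ` words (Suc p) q. monom 1 (sum_list (rows u)))
      = (\<Sum>u\<in>words (Suc p) q. monom (1::int) (Suc p + sum_list (rows u)))"
    by (subst sum.reindex) (auto simp: words_def intro: sum.cong)
  also have "\<dots> = monom 1 (Suc p) * gauss_poly (Suc p) q"
    unfolding gauss_poly_def sum_distrib_left by (simp add: mult_monom)
  finally have b: "(\<Sum>u\<in>Cons Lb ` words (Suc p) q. monom 1 (sum_list (rows u))) = monom 1 (Suc p) * gauss_poly (Suc p) q" .
  show ?thesis
    unfolding gauss_poly_def[of "Suc p" "Suc q"] words_Suc_Suc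
    by (subst sum.union_disjoint) (auto simp: finite_words a b)
qed

definition q_int :: "nat \<Rightarrow> int poly" where
  "q_int k = (\<Sum>l<k. monom 1 l)"

lemma q_int_add: "q_int (p + q) = q_int p + monom 1 p * q_int q"
  by (induction q) (simp_all add: q_int_def algebra_simps mult_monom)

lemma q_fact_0 [simp]: "q_fact 0 = 1"
  by (simp add: q_fact_def)

lemma q_fact_Suc: "q_fact (Suc k) = q_fact k * q_int (Suc k)"
  unfolding q_fact_def q_int_def by (simp add: prod.nat_ivl_Suc' mult.commute)

lemma q_fact_nonzero: "q_fact k \<noteq> 0"
proof -
  have "poly (q_fact k) 1 = fact k"
    by (induction k) (simp_all add: q_fact_Suc q_int_def poly_sum poly_monom mult.commute)
  then show ?thesis by auto
qed

text \<open>For \<open>p, q > 0\<close>, after multiplication by the \<open>q\<close>-factorials, the recursion \<open>gauss_poly_rec\<close> 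
  becomes the identity \<open>q_int_add\<close> times the \<open>q\<close>-factorial of \<open>p + q - 1\<close>.\<close>

lemma gauss_poly_q_fact: "gauss_poly p q * (q_fact p * q_fact q) = q_fact (p + q)"
proof (induction "p + q" arbitrary: p q rule: less_induct)
  case less
  show ?case
  proof (cases "p = 0 \<or> q = 0")
    case True
    then show ?thesis by auto
  next
    case False
    then obtain p' q' where pq: "p = Suc p'" "q = Suc q'"
      using not0_implies_Suc by blast
    have IH1: "gauss_poly p' q * (q_fact p' * q_fact q) = q_fact (p' + q)"
      and IH2: "gauss_poly p q' * (q_fact p * q_fact q') = q_fact (p + q')"
      using less pq by simp_all
    have "gauss_poly p q * (q_fact p * q_fact q)
        = q_int p * (gauss_poly p' q * (q_fact p' * q_fact q))
          + monom 1 p * q_int q * (gauss_poly p q' * (q_fact p * q_fact q'))"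
      unfolding pq gauss_poly_rec q_fact_Suc by (simp only: algebra_simps)
    also have "\<dots> = q_fact (p' + q) * q_int (p + q)"
      unfolding IH1 IH2 q_int_add using pq by (simp add: algebra_simps)
    also have "\<dots> = q_fact (p + q)"
      using pq q_fact_Suc[of "p' + q"] by simp
    finally show ?thesis .
  qed
qed

lemma gauss_poly_eq_q_binomial: "gauss_poly p q = q_binomial (p + q) q"
proof -
  have "q_fact q * q_fact p \<noteq> 0"
    using q_fact_nonzero by simp
  then show ?thesis
    unfolding q_binomial_def gauss_poly_q_fact[symmetric, of p q]
    by (simp add: mult.commute[of "q_fact p"])
qed


section \<open>Young diagrams\<close>

lemma young_diagram_subset_iff:
  assumes "length xs = length ys"
  shows "young_diagram xs \<subseteq> young_diagram ys \<longleftrightarrow> list_all2 (\<le>) xs ys"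
proof
  assume sub: "young_diagram xs \<subseteq> young_diagram ys"
  have "xs ! i \<le> ys ! i" if "i < length xs" for i
  proof (cases "xs ! i")
    case (Suc k)
    then have "(i, k) \<in> young_diagram xs"
      using that by (simp add: young_diagram_def)
    then have "(i, k) \<in> young_diagram ys"
      using sub by blast
    then show ?thesis
      using Suc by (simp add: young_diagram_def)
  qed simp
  then show "list_all2 (\<le>) xs ys"
    using assms by (simp add: list_all2_conv_all_nth)
qed (auto simp: young_diagram_def list_all2_conv_all_nth intro: less_le_trans)

lemma young_diagram_pad: "young_diagram (xs @ replicate k 0) = young_diagram xs"
  by (auto simp: young_diagram_def nth_append split: if_splits)

text \<open>The list \<open>rows\<close> may end in zeros, which partitions do not have; the diagram is unaffected by
  dropping them.\<close>

lemma sorted_split_zeros: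
  "sorted_wrt (\<ge>) (xs :: nat list) \<Longrightarrow> \<exists>ys k. is_partition ys \<and> xs = ys @ replicate k 0"
proof (induction xs)
  case Nil
  then show ?case by (auto simp: is_partition_def)
next
  case (Cons h t)
  show ?case
  proof (cases "h = 0")
    case True
    with Cons.prems have "h # t = replicate (length (h # t)) 0"
      by (intro replicate_eqI) auto
    then have "h # t = [] @ replicate (length (h # t)) 0" by simp
    moreover have "is_partition []"
      by (simp add: is_partition_def)
    ultimately show ?thesis by blast
  next
    case False
    from Cons obtain ys k where "is_partition ys" "t = ys @ replicate k 0"
      by auto
    with Cons.prems False have "is_partition (h # ys)" "h # t = (h # ys) @ replicate k 0"
      by (auto simp: is_partition_def)
    then show ?thesis by blast
  qed
qed

lemma young_diagram_rows: "young_diagram (rows u) \<in> young_diagrams"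
  using sorted_split_zeros[OF rows_sorted[of u]] by (auto simp: young_diagrams_def young_diagram_pad)

text \<open>The first part \<open>h\<close> requires \<open>p - h\<close> letters \<open>a\<close> in front of the first
  \<open>b\<close>; the rest of the word then has \<open>h\<close> of them left and is built from the remaining parts.\<close>

lemma word_of_rows:
  assumes "sorted_wrt (\<ge>) xs" "\<forall>x\<in>set xs. x \<le> p"
  shows "\<exists>u\<in>words p (length xs). rows u = xs"
  using assms
proof (induction xs arbitrary: p)
  case Nil
  then show ?case
    using least_word_in[of p 0] rows_least_word[of p 0] by auto
next
  case (Cons h t)
  have "\<exists>u\<in>words h (length t). rows u = t"
    by (rule Cons.IH) (use Cons.prems in simp_all)
  then obtain u where u: "u \<in> words h (length t)" "rows u = t" by blast
  let ?v = "replicate (p - h) La @ Lb # u"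
  have "?v \<in> words p (length (h # t))"
    using u Cons.prems by (simp add: words_def count_list_replicate)
  moreover have "rows ?v = h # t"
    using u by (simp add: rows_append rows_no_b words_def)
  ultimately show ?case by blast
qed

lemma young_interval_iff:
  assumes "p \<ge> 1"
  shows "(D, E) \<in> closed_interval young_lattice {} (young_diagram (replicate q p)) \<longleftrightarrow>
    D \<in> young_diagrams \<and> E \<in> young_diagrams \<and> D \<subseteq> E \<and> E \<subseteq> young_diagram (replicate q p)"
proof -
  have "{} \<in> young_diagrams"
    by (auto simp: young_diagrams_def is_partition_def young_diagram_def intro!: image_eqI[of _ _ "[]"])
  moreover have "young_diagram (replicate q p) \<in> young_diagrams"
    using assms by (auto simp: young_diagrams_def is_partition_def sorted_wrt_iff_nth_less intro!: imageI)
  ultimately show ?thesis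
    by (auto simp: closed_interval_def young_lattice_def)
qed

text \<open>A partition inside the rectangle is padded by zeros to exactly \<open>q\<close> parts, and then
  it is read as a word.\<close>

lemma diagrams_in_rectangle:
  assumes "p \<ge> 1"
  shows "(\<lambda>u. young_diagram (rows u)) ` words p q =
    {D \<in> young_diagrams. D \<subseteq> young_diagram (replicate q p)}"
proof (intro equalityI subsetI)
  fix D assume "D \<in> (\<lambda>u. young_diagram (rows u)) ` words p q"
  then obtain u where u: "u \<in> words p q" "D = young_diagram (rows u)" by blast
  have "list_all2 (\<le>) (rows u) (replicate q p)"
    using u(1) rows_le[of _ u] by (auto simp: list_all2_conv_all_nth length_rows words_def)
  then show "D \<in> {D \<in> young_diagrams. D \<subseteq> young_diagram (replicate q p)}"
    using u(1) young_diagram_rows[of u] young_diagram_subset_iff[of "rows u" "replicate q p"]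
    by (simp add: u(2) length_rows words_def)
next
  fix D assume "D \<in> {D \<in> young_diagrams. D \<subseteq> young_diagram (replicate q p)}"
  then obtain \<kappa> where k: "is_partition \<kappa>" "D = young_diagram \<kappa>"
    and sub: "young_diagram \<kappa> \<subseteq> young_diagram (replicate q p)"
    by (auto simp: young_diagrams_def)
  have box: "i < q \<and> \<kappa> ! i \<le> p" if "i < length \<kappa>" for i
  proof -
    have "\<kappa> ! i \<noteq> 0"
      using k(1) nth_mem[OF that] by (metis is_partition_def)
    then have "(i, \<kappa> ! i - 1) \<in> young_diagram \<kappa>"
      using that by (simp add: young_diagram_def)
    then have "(i, \<kappa> ! i - 1) \<in> young_diagram (replicate q p)"
      using sub by blast
    then show ?thesis
      by (auto simp: young_diagram_def)
  qed
  then have len: "length \<kappa> \<le> q"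
    by (meson leI less_irrefl)
  let ?xs = "\<kappa> @ replicate (q - length \<kappa>) 0"
  have "sorted_wrt (\<ge>) ?xs"
    using k(1) by (auto simp: is_partition_def sorted_wrt_append sorted_wrt_iff_nth_less[of _ "replicate _ _"])
  moreover have "\<forall>x\<in>set ?xs. x \<le> p"
    using box by (auto simp: in_set_conv_nth)
  ultimately obtain u where "u \<in> words p (length ?xs)" "rows u = ?xs"
    using word_of_rows by blast
  then show "D \<in> (\<lambda>u. young_diagram (rows u)) ` words p q"
    using len k(2) young_diagram_pad[of \<kappa>] by (intro image_eqI[of _ _ u]) simp_all
qed

text \<open>Both orders are the componentwise order of the parts, so the map is an isomorphism as soon as it is
  onto; injectivity follows by antisymmetry.\<close>

lemma O_poset_young:
  assumes "p \<ge> 1"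
  shows "O_poset (Suc (p + q)) q \<simeq> closed_interval young_lattice {} (young_diagram (replicate q p))"
    (is "?O \<simeq> ?Y")
proof -
  define f where "f T = young_diagram (rows (shape T))" for T
  have f: "f (snake_of_shape u) = young_diagram (rows u)" for u
    by (simp add: f_def shape_snake_of_shape)
  have FO: "Field ?O = snake_of_shape ` words p q"
    by (simp add: O_poset_def O_orbit_eq)
  have FY: "Field ?Y = {D \<in> young_diagrams. D \<subseteq> young_diagram (replicate q p)}"
    unfolding Field_def using young_interval_iff[OF assms] by blast
  have le: "young_diagram (rows u) \<subseteq> young_diagram (rows v) \<longleftrightarrow> u \<preceq> v"
    if "u \<in> words p q" "v \<in> words p q" for u v
  proof -
    have "length (rows u) = length (rows v)"
      using that by (simp add: length_rows words_def)
    then show ?thesis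
      using that by (auto simp: young_diagram_subset_iff swap_le_iff_rows)
  qed
  have img: "f ` Field ?O = Field ?Y"
    unfolding FO FY image_image f by (rule diagrams_in_rectangle[OF assms])
  have ord: "(T, T') \<in> ?O \<longleftrightarrow> (f T, f T') \<in> ?Y" if TT': "T \<in> Field ?O" "T' \<in> Field ?O" for T T'
  proof -
    obtain u v where uv: "T = snake_of_shape u" "T' = snake_of_shape v" "u \<in> words p q" "v \<in> words p q"
      using TT' unfolding FO by blast
    have "f T' \<subseteq> young_diagram (replicate q p)"
      using TT'(2) img unfolding FY by blast
    then have "(f T, f T') \<in> ?Y \<longleftrightarrow> f T \<subseteq> f T'"
      unfolding young_interval_iff[OF assms] by (simp add: f_def young_diagram_rows)
    also have "\<dots> \<longleftrightarrow> u \<preceq> v"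
      using le uv by (simp add: f)
    also have "\<dots> \<longleftrightarrow> (T, T') \<in> ?O"
      using uv unfolding O_poset_iff by auto
    finally show ?thesis ..
  qed
  have "inj_on f (Field ?O)"
  proof (rule inj_onI)
    fix T T' assume TT': "T \<in> Field ?O" "T' \<in> Field ?O" "f T = f T'"
    then have "(f T, f T) \<in> ?Y" "(f T, f T') \<in> ?Y" "(f T', f T) \<in> ?Y"
      using ord[of T T] O_poset_partial_order[of "Suc (p + q)" q]
      by (auto simp: partial_order_on_def preorder_on_def refl_on_def O_poset_def)
    then have "(T, T') \<in> ?O" "(T', T) \<in> ?O"
      using ord TT' by blast+
    then show "T = T'"
      using O_poset_partial_order[of "Suc (p + q)" q] by (auto simp: partial_order_on_def dest: antisymD)
  qed
  then have "iso ?O ?Y f"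
    using img ord by (auto simp: iso_iff2 bij_betw_def)
  then show ?thesis
    unfolding isomorphic_def by blast
qed


section \<open>The structure of the orbit posets\<close>

theorem theorem7p13:
  fixes n :: nat and w w1 w2 :: word
  assumes "n \<ge> 1"
    and "length w = n - 1" and "length w1 = n - 1" and "length w2 = n - 1"
  shows
    \<comment> \<open>(a)\<close>
    "(\<forall>j\<in>{1..n}. \<exists>p q. p \<ge> 1 \<and> q \<ge> 1 \<and> O_poset (n + 2) j \<simeq> grid_poset p q)
     \<and>
     (\<forall>j\<in>{1..n}. graded (O_poset (n + 2) j) \<and>
        (\<exists>N k. k \<le> N \<and> rank_generating_function (O_poset (n + 2) j) = q_binomial N k))
     \<and>
     (\<forall>j\<in>{1..n}. \<exists>p q. p \<ge> 1 \<and> q \<ge> 1 \<and>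
        O_poset (n + 2) j \<simeq> closed_interval young_lattice {} (young_diagram (replicate p q)))
     \<and>
     (\<exists>j\<in>{1..n}. \<exists>x y. (x, y) \<in> O_poset (n + 2) j \<and>
        L_poset w \<simeq> closed_interval (O_poset (n + 2) j) x y \<and>
        I_poset w \<simeq> closed_interval (O_poset (n + 2) j) x y)
     \<and>
     ((\<exists>j\<in>{1..n}. interval_in (I_poset w1) (O_poset (n + 2) j) \<and>
                    interval_in (I_poset w2) (O_poset (n + 2) j))
        \<longleftrightarrow> (\<exists>X\<in>orbits n. G w1 \<in> X \<and> G w2 \<in> X))
     \<and>
     (\<forall>j\<in>{1..n}. O_orbit (n + 2) j =
        \<Union>{Field (I_poset v) | v. length v = n - 1 \<and> interval_in (I_poset v) (O_poset (n + 2) j)})"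
proof (intro conjI ballI)
  fix j assume j: "j \<in> {1..n}"
  let ?p = "n + 1 - j"
  have n: "n + 2 = Suc (?p + j)" and pos: "?p \<ge> 1" "j \<ge> 1" using j by auto
  show "\<exists>p q. p \<ge> 1 \<and> q \<ge> 1 \<and> O_poset (n + 2) j \<simeq> grid_poset p q"
    unfolding n using grid_poset_eq[OF pos] isomorphic_refl pos by metis
  show "graded (O_poset (n + 2) j)"
    unfolding n by (rule graded_O_poset)
  show "\<exists>N k. k \<le> N \<and> rank_generating_function (O_poset (n + 2) j) = q_binomial N k"
    unfolding n rank_generating_function_O_poset gauss_poly_eq_q_binomial using le_add2 by blast
  show "\<exists>p q. p \<ge> 1 \<and> q \<ge> 1 \<and>
        O_poset (n + 2) j \<simeq> closed_interval young_lattice {} (young_diagram (replicate p q))"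
    unfolding n using O_poset_young[OF pos(1), of j] pos by blast
  show "O_orbit (n + 2) j =
        \<Union>{Field (I_poset v) | v. length v = n - 1 \<and> interval_in (I_poset v) (O_poset (n + 2) j)}"
    by (rule O_orbit_covered[OF j])
next
  show "\<exists>j\<in>{1..n}. \<exists>x y. (x, y) \<in> O_poset (n + 2) j \<and>
        L_poset w \<simeq> closed_interval (O_poset (n + 2) j) x y \<and>
        I_poset w \<simeq> closed_interval (O_poset (n + 2) j) x y"
    using snake_interval_bounds(1,2)[OF assms(2,1)] isomorphic_refl
    unfolding I_poset_eq L_poset_eq[OF assms(2,1)] by blast
  show "(\<exists>j\<in>{1..n}. interval_in (I_poset w1) (O_poset (n + 2) j) \<and>
                    interval_in (I_poset w2) (O_poset (n + 2) j))
        \<longleftrightarrow> (\<exists>X\<in>orbits n. G w1 \<in> X \<and> G w2 \<in> X)"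
    using interval_in_O_poset_iff[OF assms(3,1)] interval_in_O_poset_iff[OF assms(4,1)]
      snake_interval_bounds(1)[OF assms(3,1)]
    unfolding common_orbit_iff[OF assms(3,4,1)] by auto
qed

end
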